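(* Let $\rho=(r_n)_n$ be an increasing sequence in $[0,1)$ with $r_n\to1$ as $n\to\infty$. Let $\Phi:\mathbb{D}\to\mathbb{D}$ be holomorphic on $\mathbb{D}$ and continuous on $\overline{\mathbb{D}}$ (i.e. $\Phi$ extends continuously to $\overline{\mathbb{D}}$). Then $f\circ\Phi$ belongs to $\mathcal{U}_A(\mathbb{D})$ for every $f\in\mathcal{U}_A(\mathbb{D},\rho)$ if and only if $\Phi$ is a rotation.
   Context: $\mathbb{D}$ is the open unit disc, $\mathbb{T}=\partial\mathbb{D}$ the unit circle, and $H(\mathbb{D})$ the space of holomorphic functions on $\mathbb{D}$. For an increasing sequence $\rho=(r_n)_n$ in $[0,1)$ with $r_n\to1$, $\mathcal{U}_A(\mathbb{D},\rho)$ denotes the set of all $f\in H(\mathbb{D})$ such that: for any compact subset $K\subset\mathbb{T}$, $K\neq\mathbb{T}$, and any continuous function $\varphi:K\to\mathbb{C}$, there exists an increasing sequence $(n_k)_k$ in $\mathbb{N}$ such that $\sup_{\zeta\in K}|f(r_{n_k}\zeta)-\varphi(\zeta)|\to0$ as $k\to\infty$. The class of Abel universal functions is $\mathcal{U}_A(\mathbb{D})=\bigcup_{\rho}\mathcal{U}_A(\mathbb{D},\rho)$, the union over all such sequences $\rho$. A rotation is a map $z\mapsto e^{i\theta}z$ with $\theta\in[0,2\pi]$. *)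

theory Defs
  imports "HOL-Complex_Analysis.Complex_Analysis"
begin

text \<open>
  ``Increasing'' is read in the wide sense, which is the more general one. Since the terms are
  below \<open>1\<close> and tend to \<open>1\<close>, each value is taken only finitely often, so the class
  \<open>Abel_universal\<close> below is the same as for strictly increasing sequences.
\<close>

definition admissible_radii :: "(nat \<Rightarrow> real) \<Rightarrow> bool" where
  "admissible_radii r \<longleftrightarrow> incseq r \<and> (\<forall>n. r n \<in> {0..<1}) \<and> r \<longlonglongrightarrow> 1"

text \<open>
  Functions on the disc are total functions of which only the values on \<open>ball 0 1\<close> matter;
  likewise only the values of \<open>\<phi>\<close> on \<open>K\<close> matter. The condition
  \<open>sup\<^bsub>\<zeta>\<in>K\<^esub> \<bar>f (r\<^bsub>n k\<^esub> \<zeta>) - \<phi> \<zeta>\<bar> \<longlonglongrightarrow> 0\<close> is uniform convergence on \<open>K\<close>, which is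
  also meaningful (and trivial) for empty \<open>K\<close>.
\<close>

definition Abel_universal_wrt :: "(nat \<Rightarrow> real) \<Rightarrow> (complex \<Rightarrow> complex) set" where
  "Abel_universal_wrt r =
    {f. f holomorphic_on ball 0 1 \<and>
        (\<forall>K \<phi>. compact K \<longrightarrow> K \<subseteq> sphere 0 1 \<longrightarrow> K \<noteq> sphere 0 1 \<longrightarrow> continuous_on K \<phi> \<longrightarrow>
          (\<exists>n :: nat \<Rightarrow> nat. strict_mono n \<and>
            uniform_limit K (\<lambda>k \<zeta>. f (of_real (r (n k)) * \<zeta>)) \<phi> sequentially))}"

definition Abel_universal :: "(complex \<Rightarrow> complex) set" where
  "Abel_universal = (\<Union>r\<in>Collect admissible_radii. Abel_universal_wrt r)"

definition is_disc_rotation :: "(complex \<Rightarrow> complex) \<Rightarrow> bool" where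
  "is_disc_rotation \<Phi> \<longleftrightarrow>
    (\<exists>\<theta>\<in>{0..2 * pi}. \<forall>z\<in>ball 0 1. \<Phi> z = exp (\<i> * of_real \<theta>) * z)"

end

theory Submission
  imports Defs "HOL-Computational_Algebra.Fundamental_Theorem_Algebra"
begin

text \<open>
  Abel universal functions are built as limits of polynomials, where each correction is obtained by
  Runge approximation on a disc with a thin annulus removed, the circle inside the annulus put back,
  and a small cap cut off. Hence such a function can be kept small on any prescribed
  compact set with thin trace on the circle, except on very thin and very sparse annuli.

  Now let composition with \<open>\<Phi>\<close> preserve universality. If \<open>\<bar>\<Phi> \<zeta>\<bar> < 1\<close> at a boundary point \<open>\<zeta>\<close>, then
  \<open>f \<circ> \<Phi>\<close> has a radial limit at \<open>\<zeta>\<close>, which is impossible. So \<open>\<Phi>\<close> is unimodular on the circle and reflects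
  across it. If \<open>\<bar>\<Phi>'\<bar>\<close> differs at two boundary points, the images of the two radii approach the circle at
  different rates and cannot lie in the annuli simultaneously, which excludes universality for a suitable \<open>f\<close>.
  Otherwise \<open>\<bar>\<Phi>'\<bar>\<close> is constant, so \<open>\<Phi> z = C * z ^ d\<close>, and \<open>d \<ge> 2\<close> would make \<open>f \<circ> \<Phi>\<close> agree along
  different radii.
\<close>

section \<open>Polynomial approximation on compact sets with connected complement\<close>

text \<open>The hypothesis makes \<open>f \<circ> \<Phi>\<close> universal along some sequence of
  radii that depends on \<open>f\<close> and is not known in advance. A refutation can only use that
  these radii tend to \<open>1\<close>: it either contradicts a limit at one boundary point or
  compares two boundary points at the same radius. Hence only finite sets \<open>K\<close> occur on
  that side. Two source radii are mapped to curves whose distances from the circle have an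
  asymptotic ratio. If it is not \<open>1\<close>, the distances at which \<open>f\<close> may be
  large should contain no two numbers with nearly this ratio. Annuli of width proportional to
  \<open>1 - r n\<close>, with lacunary \<open>1 - r n\<close>, have this property; as
  \<open>r\<close> is prescribed, lacunarity comes from using a sparse set of indices, which
  universality tolerates. The price for smallness on curves that reach the circle is that no cap may
  be centred at their end points. Density of the other centres suffices, because every proper
  compact \<open>K\<close> misses an open arc.\<close>

definition poly_approx :: "complex set \<Rightarrow> (complex \<Rightarrow> complex) \<Rightarrow> bool" where
  "poly_approx L g \<longleftrightarrow> (\<forall>e>0. \<exists>p. \<forall>z\<in>L. norm (g z - poly p z) < e)"

lemma poly_approxE:
  assumes "poly_approx L g" "e > 0"
  obtains p where "\<And>z. z \<in> L \<Longrightarrow> norm (g z - poly p z) < e"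
  using assms unfolding poly_approx_def by blast

section \<open>Closure properties of uniform polynomial approximability\<close>

lemma poly_approx_poly: "poly_approx L (poly p)"
  unfolding poly_approx_def
proof (intro allI impI)
  fix e :: real assume "e > 0"
  then show "\<exists>q. \<forall>z\<in>L. norm (poly p z - poly q z) < e" by (intro exI[of _ p]) simp
qed

lemma poly_approx_const: "poly_approx L (\<lambda>z. c)"
  using poly_approx_poly[of L "[:c:]"] by (simp add: poly_pCons[abs_def])

lemma poly_approx_id: "poly_approx L (\<lambda>z. z)"
proof -
  have "poly [:0, 1:] = (\<lambda>z::complex. z)" by (simp add: fun_eq_iff)
  then show ?thesis using poly_approx_poly[of L "[:0, 1:]"] by simp
qed

lemma poly_approx_cong:
  assumes "poly_approx L g" "\<And>z. z \<in> L \<Longrightarrow> g z = h z"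
  shows "poly_approx L h"
  using assms unfolding poly_approx_def by auto

lemma poly_approx_limit:
  assumes "\<And>e. e > 0 \<Longrightarrow> \<exists>h. poly_approx L h \<and> (\<forall>z\<in>L. norm (g z - h z) < e)"
  shows "poly_approx L g"
  unfolding poly_approx_def
proof (intro allI impI)
  fix e :: real assume "e > 0"
  then obtain h where h: "poly_approx L h" "\<forall>z\<in>L. norm (g z - h z) < e/2"
    using assms[of "e/2"] by auto
  obtain p where p: "\<And>z. z \<in> L \<Longrightarrow> norm (h z - poly p z) < e/2"
    using poly_approxE[OF h(1), of "e/2"] \<open>e > 0\<close> by auto
  have "norm (g z - poly p z) < e" if "z \<in> L" for z
    using norm_triangle_ineq[of "g z - h z" "h z - poly p z"] h(2) p[OF that] that by fastforce
  then show "\<exists>p. \<forall>z\<in>L. norm (g z - poly p z) < e" by blast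
qed

lemma poly_approx_add:
  assumes "poly_approx L g" "poly_approx L h"
  shows "poly_approx L (\<lambda>z. g z + h z)"
  unfolding poly_approx_def
proof (intro allI impI)
  fix e :: real assume "e > 0"
  then obtain p q where pq: "\<And>z. z \<in> L \<Longrightarrow> norm (g z - poly p z) < e/2"
      "\<And>z. z \<in> L \<Longrightarrow> norm (h z - poly q z) < e/2"
    using poly_approxE[OF assms(1), of "e/2"] poly_approxE[OF assms(2), of "e/2"]
    by (metis half_gt_zero)
  have "norm (g z + h z - poly (p + q) z) < e" if "z \<in> L" for z
    using norm_triangle_ineq[of "g z - poly p z" "h z - poly q z"] pq[OF that]
    by (simp add: algebra_simps)
  then show "\<exists>p. \<forall>z\<in>L. norm (g z + h z - poly p z) < e" by blast
qed

lemma poly_approx_bounded: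
  assumes "compact L" "poly_approx L g"
  obtains B where "B > 0" "\<And>z. z \<in> L \<Longrightarrow> norm (g z) \<le> B"
proof -
  obtain p where p: "\<And>z. z \<in> L \<Longrightarrow> norm (g z - poly p z) < 1"
    using poly_approxE[OF assms(2), of 1] by auto
  have "compact (poly p ` L)"
    by (intro compact_continuous_image continuous_intros assms)
  then obtain B where B: "B > 0" "\<And>z. z \<in> L \<Longrightarrow> norm (poly p z) \<le> B"
    using compact_imp_bounded[of "poly p ` L"] by (auto simp: bounded_pos)
  have "norm (g z) \<le> B + 1" if "z \<in> L" for z
    using norm_triangle_ineq[of "g z - poly p z" "poly p z"] p[OF that] B(2)[OF that] by simp
  with B(1) show ?thesis by (intro that[of "B+1"]) auto
qed

lemma poly_approx_mult:
  assumes L: "compact L" and g: "poly_approx L g" and h: "poly_approx L h"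
  shows "poly_approx L (\<lambda>z. g z * h z)"
proof -
  obtain B where B: "B > 0" "\<And>z. z \<in> L \<Longrightarrow> norm (g z) \<le> B"
    using poly_approx_bounded[OF L g] by blast
  show ?thesis unfolding poly_approx_def
  proof (intro allI impI)
    fix e :: real assume e: "e > 0"
    have "e / (2 * B) > 0" using e B by auto
    then obtain q where q: "\<And>z. z \<in> L \<Longrightarrow> norm (h z - poly q z) < e / (2 * B)"
      using poly_approxE[OF h] by metis
    \<comment> \<open>\<open>C\<close> bounds the approximant \<open>q\<close> rather than
      \<open>h\<close>, so \<open>p\<close> is chosen after \<open>q\<close>.\<close>
    obtain C where C: "C > 0" "\<And>z. z \<in> L \<Longrightarrow> norm (poly q z) \<le> C"
      using poly_approx_bounded[OF L poly_approx_poly] by metis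
    have "e / (2 * C) > 0" using e C by auto
    then obtain p where p: "\<And>z. z \<in> L \<Longrightarrow> norm (g z - poly p z) < e / (2 * C)"
      using poly_approxE[OF g] by metis
    have "norm (g z * h z - poly (p * q) z) < e" if z: "z \<in> L" for z
    proof -
      have "g z * h z - poly (p * q) z = g z * (h z - poly q z) + (g z - poly p z) * poly q z"
        by (simp add: algebra_simps)
      also have "norm \<dots> \<le> norm (g z) * norm (h z - poly q z) + norm (g z - poly p z) * norm (poly q z)"
        by (metis norm_mult norm_triangle_ineq)
      also have "\<dots> \<le> B * norm (h z - poly q z) + norm (g z - poly p z) * C"
        by (intro add_mono mult_right_mono mult_left_mono B C z) auto
      also have "\<dots> < B * (e / (2 * B)) + e / (2 * C) * C"
        by (intro add_strict_mono mult_strict_left_mono mult_strict_right_mono p q z B C)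
      also have "\<dots> = e" using B C by simp
      finally show ?thesis .
    qed
    then show "\<exists>p. \<forall>z\<in>L. norm (g z * h z - poly p z) < e" by blast
  qed
qed

lemma poly_approx_power:
  assumes "compact L" "poly_approx L g"
  shows "poly_approx L (\<lambda>z. g z ^ n)"
  by (induction n) (auto intro: poly_approx_const poly_approx_mult assms)

lemma poly_approx_sum:
  assumes "\<And>i. i \<in> I \<Longrightarrow> poly_approx L (g i)"
  shows "poly_approx L (\<lambda>z. \<Sum>i\<in>I. g i z)"
  using assms
  by (induction I rule: infinite_finite_induct) (auto intro: poly_approx_const poly_approx_add)

section \<open>Geometric series, pole pushing and rational functions\<close>

text \<open>The partial sums of the geometric series are polynomials in \<open>g\<close>, with
  remainder \<open>g ^ n / (1 - g)\<close>.\<close>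

lemma poly_approx_geometric:
  assumes L: "compact L" and g: "poly_approx L g" and c: "c < 1" "\<And>z. z \<in> L \<Longrightarrow> norm (g z) \<le> c"
  shows "poly_approx L (\<lambda>z. 1 / (1 - g z))"
proof (rule poly_approx_limit)
  fix e :: real assume e: "e > 0"
  \<comment> \<open>A negative \<open>c\<close> can occur when \<open>L\<close> is empty; the powers
    of \<open>d\<close> converge to \<open>0\<close> in that case too.\<close>
  define d where "d = max c 0"
  have d: "0 \<le> d" "d < 1" "\<And>z. z \<in> L \<Longrightarrow> norm (g z) \<le> d"
    using c by (auto simp: d_def le_max_iff_disj)
  have "(\<lambda>n. d ^ n) \<longlonglongrightarrow> 0" using d by (intro LIMSEQ_power_zero) auto
  then have "eventually (\<lambda>n. d ^ n < e * (1 - d)) sequentially"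
    using e d by (intro order_tendstoD) auto
  then obtain n where n: "d ^ n < e * (1 - d)" by (auto simp: eventually_sequentially)
  have "norm (1 / (1 - g z) - (\<Sum>i<n. g z ^ i)) < e" if z: "z \<in> L" for z
  proof -
    have lt: "norm (g z) < 1" using d z by fastforce
    then have ne: "1 - g z \<noteq> 0" by auto
    have "1 / (1 - g z) - (\<Sum>i<n. g z ^ i) = g z ^ n / (1 - g z)"
      using ne by (subst sum_gp_strict) (auto simp: field_simps)
    also have "norm \<dots> = norm (g z) ^ n / norm (1 - g z)"
      by (simp add: norm_divide norm_power)
    also have "\<dots> \<le> d ^ n / (1 - d)"
    proof (intro frac_le power_mono d z)
      show "1 - d \<le> norm (1 - g z)"
        using norm_triangle_ineq2[of 1 "g z"] d(3)[OF z] by simp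
    qed (use d in auto)
    also have "\<dots> < e" using n d by (simp add: field_simps)
    finally show ?thesis .
  qed
  moreover have "poly_approx L (\<lambda>z. \<Sum>i<n. g z ^ i)"
    by (intro poly_approx_sum poly_approx_power L g)
  ultimately show "\<exists>h. poly_approx L h \<and> (\<forall>z\<in>L. norm (1 / (1 - g z) - h z) < e)" by blast
qed

text \<open>Pole pushing: the admissible poles form an open and closed subset of \<open>- L\<close> containing
  all points far out.\<close>

lemma poly_approx_pole:
  assumes L: "compact L" and conn: "connected (- L)" and a: "a \<notin> L"
  shows "poly_approx L (\<lambda>z. 1 / (z - a))"
proof -
  define S where "S = {a \<in> - L. poly_approx L (\<lambda>z. 1 / (z - a))}"
  \<comment> \<open>Expansion of \<open>1 / (z - b)\<close> about \<open>a\<close>: it is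
    \<open>1 / (z - a)\<close> times a geometric series of ratio \<open>(b - a) / (z - a)\<close>,
    at most \<open>1/2\<close> in modulus.\<close>
  have near: "poly_approx L (\<lambda>z. 1 / (z - b))"
    if a: "a \<notin> L" "poly_approx L (\<lambda>z. 1 / (z - a))" and d: "d > 0" "\<And>z. z \<in> L \<Longrightarrow> 2 * d \<le> norm (z - a)"
      and b: "norm (b - a) < d" for a b d
  proof -
    have "poly_approx L (\<lambda>z. 1 / (1 - (b - a) * (1 / (z - a))))"
    proof (rule poly_approx_geometric[OF L, where c = "1/2"])
      show "poly_approx L (\<lambda>z. (b - a) * (1 / (z - a)))"
        by (intro poly_approx_mult L poly_approx_const a)
      show "norm ((b - a) * (1 / (z - a))) \<le> 1/2" if "z \<in> L" for z
      proof -
        have "norm (b - a) / norm (z - a) \<le> d / (2 * d)"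
          using d(2)[OF that] d(1) b by (intro frac_le) auto
        then show ?thesis using d(1) by (simp add: norm_mult norm_divide)
      qed
    qed auto
    then have "poly_approx L (\<lambda>z. 1 / (z - a) * (1 / (1 - (b - a) * (1 / (z - a)))))"
      by (intro poly_approx_mult L a)
    then show ?thesis
    proof (rule poly_approx_cong)
      fix z assume z: "z \<in> L"
      have "z \<noteq> a" using a z by auto
      moreover have "z \<noteq> b" using d(2)[OF z] b d(1) by auto
      ultimately show "1 / (z - a) * (1 / (1 - (b - a) * (1 / (z - a)))) = 1 / (z - b)"
        by (simp add: divide_simps)
    qed
  qed
  \<comment> \<open>The factor 4 leaves room to move the pole by less than \<open>d\<close> and
    still keep distance \<open>2 * d\<close> from \<open>L\<close>, so that \<open>near\<close> also
    works from \<open>b\<close> back to \<open>a\<close>.\<close>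
  have dist: "\<exists>d>0. \<forall>z\<in>L. 4 * d \<le> norm (z - a)" if "a \<notin> L" for a
  proof -
    obtain e where e: "e > 0" "ball a e \<subseteq> - L"
      using open_contains_ball[of "- L"] compact_imp_closed[OF L] \<open>a \<notin> L\<close> by auto
    have "e \<le> norm (z - a)" if "z \<in> L" for z
      using e(2) that by (metis ComplD dist_norm dist_commute mem_ball not_less subsetD)
    then show ?thesis using e(1) by (intro exI[of _ "e/4"]) auto
  qed
  have "open S" unfolding open_dist
  proof
    fix a assume "a \<in> S"
    then have a: "a \<notin> L" "poly_approx L (\<lambda>z. 1 / (z - a))" by (auto simp: S_def)
    obtain d where d: "d > 0" "\<forall>z\<in>L. 4 * d \<le> norm (z - a)" using dist[OF a(1)] by blast
    have "b \<in> S" if "dist b a < d" for b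
    proof -
      have "b \<notin> L" using d that by (force simp: dist_norm)
      moreover have "poly_approx L (\<lambda>z. 1 / (z - b))"
        using d that by (intro near[OF a, of d]) (force simp: dist_norm)+
      ultimately show ?thesis by (auto simp: S_def)
    qed
    then show "\<exists>e>0. \<forall>b. dist b a < e \<longrightarrow> b \<in> S" using d(1) by blast
  qed
  then have op: "openin (top_of_set (- L)) S"
    by (intro open_subset) (auto simp: S_def)
  have "open (- L - S)" unfolding open_dist
  proof
    fix a assume "a \<in> - L - S"
    then have a: "a \<notin> L" "a \<notin> S" by auto
    obtain d where d: "d > 0" "\<forall>z\<in>L. 4 * d \<le> norm (z - a)" using dist[OF a(1)] by blast
    have "b \<in> - L - S" if "dist b a < d" for b
    proof -
      have "b \<notin> L" using d that by (force simp: dist_norm)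
      moreover have "b \<notin> S"
      proof
        assume "b \<in> S"
        then have b: "poly_approx L (\<lambda>z. 1 / (z - b))" by (auto simp: S_def)
        have "2 * d \<le> norm (z - b)" if z: "z \<in> L" for z
        proof -
          have "4 * d \<le> norm (z - a)" using d z by blast
          also have "\<dots> \<le> norm (z - b) + norm (b - a)" using norm_triangle_ineq[of "z - b" "b - a"] by simp
          finally show ?thesis using \<open>dist b a < d\<close> d(1) by (simp add: dist_norm)
        qed
        then have "poly_approx L (\<lambda>z. 1 / (z - a))"
          using that by (intro near[OF \<open>b \<notin> L\<close> b d(1)]) (auto simp: dist_norm norm_minus_commute)
        with a show False by (auto simp: S_def)
      qed
      ultimately show ?thesis by auto
    qed
    then show "\<exists>e>0. \<forall>b. dist b a < e \<longrightarrow> b \<in> - L - S" using d(1) by blast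
  qed
  then have cl: "closedin (top_of_set (- L)) S"
    by (auto simp: closedin_def S_def intro!: open_subset)
  obtain R where R: "R > 0" "\<And>z. z \<in> L \<Longrightarrow> norm z \<le> R"
    using compact_imp_bounded[OF L] by (auto simp: bounded_pos)
  \<comment> \<open>A pole at twice the radius of \<open>L\<close>: here \<open>1 / (z - b)\<close>
    expands in powers of \<open>z / b\<close>, which is at most \<open>1/2\<close> in modulus on
    \<open>L\<close>.\<close>
  define b where "b = complex_of_real (2 * R)"
  have nb: "norm b = 2 * R" using R by (simp add: b_def)
  have "poly_approx L (\<lambda>z. - 1 / b * (1 / (1 - z * (1 / b))))"
  proof (intro poly_approx_mult L poly_approx_const poly_approx_geometric[where c = "1/2"])
    show "poly_approx L (\<lambda>z. z)" by (rule poly_approx_id)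
    show "norm (z * (1 / b)) \<le> 1 / 2" if "z \<in> L" for z
      using R(2)[OF that] R(1) by (simp add: norm_mult norm_divide nb field_simps)
  qed auto
  then have "poly_approx L (\<lambda>z. 1 / (z - b))"
  proof (rule poly_approx_cong)
    fix z assume z: "z \<in> L"
    have "b \<noteq> 0" "z \<noteq> b" using R(2)[OF z] nb R(1) by auto
    then show "- 1 / b * (1 / (1 - z * (1 / b))) = 1 / (z - b)"
      by (simp add: divide_simps)
  qed
  moreover have "b \<notin> L" using R nb by force
  ultimately have "b \<in> S" by (auto simp: S_def)
  then have "S = - L" using conn op cl by (auto simp: connected_clopen)
  with a show ?thesis by (auto simp: S_def)
qed

text \<open>The denominator splits into linear factors, and pole pushing covers the reciprocal of
  each.\<close>

lemma poly_approx_inverse_poly: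
  assumes L: "compact L" "connected (- L)" and "\<And>z. z \<in> L \<Longrightarrow> poly p z \<noteq> 0"
  shows "poly_approx L (\<lambda>z. 1 / poly p z)"
  using assms(3)
proof (induction "degree p" arbitrary: p)
  case 0
  then obtain c where "p = [:c:]" by (metis degree_eq_zeroE)
  then show ?case by (simp add: poly_approx_const)
next
  case (Suc n)
  then have "\<not> constant (poly p)" by (simp add: constant_degree)
  then obtain a where a: "poly p a = 0" using fundamental_theorem_of_algebra by blast
  then obtain q where q: "p = [:-a, 1:] * q" using poly_eq_0_iff_dvd by (metis dvdE)
  have "q \<noteq> 0" using q Suc.hyps(2) by auto
  then have "degree p = degree [:-a, 1:] + degree q" unfolding q by (intro degree_mult_eq) auto
  then have "degree q = n" using Suc.hyps(2) by simp
  moreover have "poly q z \<noteq> 0" if "z \<in> L" for z using Suc.prems[OF that] q by auto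
  ultimately have 1: "poly_approx L (\<lambda>z. 1 / poly q z)" using Suc.hyps(1) by simp
  have "a \<notin> L" using a Suc.prems by blast
  from poly_approx_mult[OF L(1) poly_approx_pole[OF L this] 1]
  have "poly_approx L (\<lambda>z. 1 / (z - a) * (1 / poly q z))" .
  then show ?case by (rule poly_approx_cong) (simp add: q algebra_simps)
qed

text \<open>The rational functions \<open>1 / (1 + (z / s) ^ n)\<close> converge to the step function off the circle of
  radius \<open>s\<close>; their poles may be pushed to infinity because \<open>- L\<close> is connected.\<close>

lemma poly_approx_step_function:
  assumes L: "compact L" "connected (- L)"
    and s: "0 \<le> a" "a < s" "s < b" and ab: "\<And>z. z \<in> L \<Longrightarrow> norm z \<le> a \<or> b \<le> norm z"
  shows "poly_approx L (\<lambda>z. if norm z < s then 1 else 0)"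
proof (rule poly_approx_limit)
  fix e :: real assume e: "e > 0"
  \<comment> \<open>\<open>c\<close> bounds \<open>norm z / s\<close> on the inner part of
    \<open>L\<close> and its reciprocal on the outer part, so that one power \<open>c ^ n\<close>
    controls both.\<close>
  define c where "c = max (a / s) (s / b)"
  have c: "0 \<le> c" "c < 1" using s by (auto simp: c_def le_max_iff_disj)
  have "(\<lambda>n. c ^ n) \<longlonglongrightarrow> 0" using c by (intro LIMSEQ_power_zero) auto
  \<comment> \<open>The bound \<open>1/2\<close> keeps \<open>1 + (z / s) ^ n\<close> away from
    \<open>0\<close>; given this, \<open>e/2\<close> yields the error \<open>e\<close>.\<close>
  then have "eventually (\<lambda>n. c ^ n < min (1/2) (e/2)) sequentially"
    using e by (intro order_tendstoD) auto
  then obtain n where n: "c ^ n < 1/2" "c ^ n < e/2" by (auto simp: eventually_sequentially)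
  have err: "c ^ n / (1 - c ^ n) < e"
  proof -
    have "c ^ n / (1 - c ^ n) \<le> c ^ n / (1/2)"
      using n c by (intro divide_left_mono) auto
    then show ?thesis using n by simp
  qed
  define p :: "complex poly" where "p = 1 + monom (1 / of_real s ^ n) n"
  have p: "poly p z = 1 + (z / of_real s) ^ n" for z :: complex
    by (simp add: p_def poly_monom power_divide)
  have lo: "norm ((z / of_real s) ^ n) \<le> c ^ n" if "norm z \<le> a" for z :: complex
  proof -
    have "norm z / s \<le> c" using that s by (auto simp: c_def le_max_iff_disj divide_right_mono)
    then show ?thesis using s by (simp add: norm_power norm_divide power_mono)
  qed
  have hi: "1 \<le> c ^ n * norm ((z / of_real s) ^ n)" if "b \<le> norm z" for z :: complex
  proof -
    have "1 = s / b * (b / s)" using s by simp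
    also have "\<dots> \<le> c * (norm z / s)"
    proof (intro mult_mono divide_right_mono)
      show "s / b \<le> c" by (simp add: c_def)
    qed (use s that c in auto)
    finally have "1 ^ n \<le> (c * (norm z / s)) ^ n" by (rule power_mono) simp
    then show ?thesis using s by (simp add: norm_power norm_divide power_mult_distrib power_divide)
  qed
  have main: "poly p z \<noteq> 0 \<and> norm ((if norm z < s then 1 else 0) - 1 / poly p z) < e" if z: "z \<in> L" for z
  proof (cases "norm z \<le> a")
    case True
    let ?u = "(z / of_real s) ^ n"
    have u: "norm ?u \<le> c ^ n" using lo True .
    have d: "1 - c ^ n \<le> norm (1 + ?u)" using norm_triangle_ineq2[of 1 "- ?u"] u by simp
    then have ne: "1 + ?u \<noteq> 0" using n by auto
    have "1 - 1 / (1 + ?u) = ?u / (1 + ?u)" using ne by (simp add: field_simps)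
    also have "norm \<dots> = norm ?u / norm (1 + ?u)" by (rule norm_divide)
    also have "\<dots> \<le> c ^ n / (1 - c ^ n)" using u d n c by (intro frac_le) auto
    finally have "norm (1 - 1 / (1 + ?u)) < e" using err by linarith
    then show ?thesis using True s ne by (simp add: p)
  next
    case False
    then have b: "b \<le> norm z" using ab z by blast
    let ?u = "(z / of_real s) ^ n"
    have u: "1 \<le> c ^ n * norm ?u" using hi b .
    then have cn: "c ^ n > 0" by (metis c(1) less_le mult_zero_left not_one_le_zero zero_le_power)
    then have u': "1 / c ^ n \<le> norm ?u" using u by (simp add: field_simps)
    have d: "(1 - c ^ n) / c ^ n \<le> norm (1 + ?u)"
    proof -
      have "(1 - x) / x = 1 / x - 1" if "x > 0" for x :: real using that by (simp add: field_simps)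
      then have "(1 - c ^ n) / c ^ n = 1 / c ^ n - 1" using cn by blast
      moreover have "norm ?u - 1 \<le> norm (1 + ?u)"
        using norm_triangle_ineq2[of ?u "- 1"] by (simp add: add.commute)
      ultimately show ?thesis using u' by linarith
    qed
    have pos: "(1 - c ^ n) / c ^ n > 0" using cn n by simp
    then have ne: "1 + ?u \<noteq> 0" using d by auto
    have "norm (1 / (1 + ?u)) \<le> 1 / ((1 - c ^ n) / c ^ n)"
      unfolding norm_divide using d pos by (intro frac_le) auto
    then have "norm (1 / (1 + ?u)) < e" using err by simp
    then show ?thesis using b s ne by (simp add: p)
  qed
  then have "poly_approx L (\<lambda>z. 1 / poly p z)"
    by (intro poly_approx_inverse_poly L) auto
  with main show "\<exists>h. poly_approx L h \<and> (\<forall>z\<in>L. norm ((if norm z < s then 1 else 0) - h z) < e)"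
    by blast
qed

text \<open>The cap \<open>1 - \<eta> < \<xi> \<bullet> z\<close> joins the two halves of the removed annulus to the exterior of the disc.\<close>

lemma poly_approx_slit_disc_minus_annulus:
  fixes \<xi> :: complex
  assumes \<xi>: "norm \<xi> = 1" and par: "0 < \<eta>" "\<eta> < 1" "0 < \<delta>" "1 - \<eta> < \<rho> - \<delta>" "\<rho> < 1"
  defines "L \<equiv> {z. norm z \<le> 1 \<and> \<xi> \<bullet> z \<le> 1 - \<eta> \<and> (norm z \<le> \<rho> - \<delta> \<or> norm z = \<rho> \<or> \<rho> + \<delta> \<le> norm z)}"
  shows "poly_approx L (\<lambda>z. if norm z = \<rho> then poly q z else 0)"
proof -
  have "bounded L" unfolding bounded_iff by (auto simp: L_def)
  moreover have "closed L" unfolding L_def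
    by (intro closed_Collect_conj closed_Collect_disj closed_Collect_le closed_Collect_eq continuous_intros)
  ultimately have L: "compact L" by (simp add: compact_eq_bounded_closed)
  define H where "H = {z. 1 - \<eta> < \<xi> \<bullet> z}"
  define A where "A = (\<lambda>s t. {z::complex. s < norm (z - 0) \<and> norm (z - 0) < t})"
  have H: "connected H" unfolding H_def by (intro convex_connected convex_halfspace_gt)
  have inH: "of_real t * \<xi> \<in> H" "norm (of_real t * \<xi>) = t" if "1 - \<eta> < t" for t
  proof -
    have "\<xi> \<bullet> \<xi> = 1" using \<xi> by (simp add: norm_eq_1)
    then show "of_real t * \<xi> \<in> H" using that by (simp add: H_def scaleR_conv_of_real[symmetric])
    show "norm (of_real t * \<xi>) = t" using \<xi> that par by (simp add: norm_mult)
  qed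
  have A: "connected (A s t \<union> H)" if "s < t" "1 - \<eta> < t" for s t
  proof (intro connected_Un H)
    show "connected (A s t)" unfolding A_def by (intro connected_annulus) simp
    \<comment> \<open>A radius inside the annulus and beyond \<open>1 - \<eta>\<close>: the point at
      this radius in direction \<xi> lies in both the annulus and \<open>H\<close>.\<close>
    define u where "u = (max s (1 - \<eta>) + t) / 2"
    have "s < u" "1 - \<eta> < u" "u < t" using that by (auto simp: u_def)
    then have "of_real u * \<xi> \<in> A s t \<inter> H" using inH[of u] unfolding A_def by simp
    then show "A s t \<inter> H \<noteq> {}" by blast
  qed
  have O: "connected (- cball 0 1 \<union> H)"
  proof (intro connected_Un H)
    show "connected (- cball (0::complex) 1)" by (intro connected_complement_bounded_convex) auto
    have "of_real 2 * \<xi> \<in> - cball 0 1 \<inter> H" using inH[of 2] par by simp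
    then show "- cball 0 1 \<inter> H \<noteq> {}" by blast
  qed
  have "- L = (- cball 0 1 \<union> H) \<union> ((A (\<rho> - \<delta>) \<rho> \<union> H) \<union> (A \<rho> (\<rho> + \<delta>) \<union> H))"
    by (auto simp: L_def A_def H_def)
  also have "connected \<dots>"
  proof -
    have "H \<noteq> {}" using inH[of 2] par by auto
    then have ne: "(A (\<rho> - \<delta>) \<rho> \<union> H) \<inter> (A \<rho> (\<rho> + \<delta>) \<union> H) \<noteq> {}"
      "(- cball 0 1 \<union> H) \<inter> ((A (\<rho> - \<delta>) \<rho> \<union> H) \<union> (A \<rho> (\<rho> + \<delta>) \<union> H)) \<noteq> {}" by auto
    have "connected (A (\<rho> - \<delta>) \<rho> \<union> H)" "connected (A \<rho> (\<rho> + \<delta>) \<union> H)"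
      using par by (intro A; simp)+
    then show ?thesis using ne O connected_Un by metis
  qed
  finally have conn: "connected (- L)" .
  \<comment> \<open>On \<open>L\<close> the difference of the two step functions is the indicator of
    the circle of radius \<rho>, since \<open>L\<close> has no other points strictly between the
    radii \<open>\<rho> - \<delta>\<close> and \<open>\<rho> + \<delta>\<close>.\<close>
  have 1: "poly_approx L (\<lambda>z. if norm z < \<rho> - \<delta>/2 then 1 else 0)"
    by (rule poly_approx_step_function[OF L conn, of "\<rho> - \<delta>" _ \<rho>]) (use par in \<open>auto simp: L_def\<close>)
  have 2: "poly_approx L (\<lambda>z. if norm z < \<rho> + \<delta>/2 then 1 else 0)"
    by (rule poly_approx_step_function[OF L conn, of \<rho> _ "\<rho> + \<delta>"]) (use par in \<open>auto simp: L_def\<close>)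
  have "poly_approx L (\<lambda>z. ((if norm z < \<rho> + \<delta>/2 then 1 else 0) + (-1) * (if norm z < \<rho> - \<delta>/2 then 1 else 0)) * poly q z)"
    by (intro poly_approx_mult poly_approx_add L 1 2 poly_approx_const poly_approx_poly)
  then show ?thesis
    by (rule poly_approx_cong) (use par in \<open>auto simp: L_def\<close>)
qed

section \<open>Continuous functions on proper compact subsets of the circle\<close>

text \<open>The open disc and the exterior stay connected when circle points, which lie in both
  closures, are added; a circle point outside \<open>K\<close> links the two pieces.\<close>

lemma connected_Compl_proper_subset_circle:
  fixes K :: "complex set"
  assumes K: "K \<subseteq> sphere 0 1" "K \<noteq> sphere 0 1"
  shows "connected (- K)"
proof -
  have "connected (ball 0 1 \<union> (sphere 0 1 - K))"
    by (rule connected_intermediate_closure[OF connected_ball[of 0 1]]) auto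
  moreover have "connected (- cball 0 1 \<union> (sphere 0 1 - K))"
  proof (rule connected_intermediate_closure)
    show "connected (- cball (0::complex) 1)" by (intro connected_complement_bounded_convex) auto
  qed (auto simp: closure_complement)
  moreover have "(ball 0 1 \<union> (sphere 0 1 - K)) \<inter> (- cball 0 1 \<union> (sphere 0 1 - K)) \<noteq> {}"
    using K by blast
  ultimately have "connected ((ball 0 1 \<union> (sphere 0 1 - K)) \<union> (- cball 0 1 \<union> (sphere 0 1 - K)))"
    by (rule connected_Un)
  also have "(ball 0 1 \<union> (sphere 0 1 - K)) \<union> (- cball 0 1 \<union> (sphere 0 1 - K)) = - K"
    using K by force
  finally show ?thesis .
qed

text \<open>Stone-Weierstrass gives polynomials in the real and imaginary parts, so it is enough to
  approximate \<open>cnj z\<close>. On the circle this is \<open>1 / z\<close>, and as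
  \<open>K\<close> omits a circle point, the pole at \<open>0\<close> can be pushed to
  infinity.\<close>

lemma poly_approx_continuous_on_circle:
  assumes K: "compact K" "K \<subseteq> sphere 0 1" "K \<noteq> sphere 0 1" and \<phi>: "continuous_on K \<phi>"
  shows "poly_approx K \<phi>"
proof -
  have z: "poly_approx K (\<lambda>z. z)" by (rule poly_approx_id)
  have "poly_approx K (\<lambda>z. 1 / (z - 0))"
    using K by (intro poly_approx_pole connected_Compl_proper_subset_circle) auto
  then have iz: "poly_approx K (\<lambda>z. cnj z)"
  proof (rule poly_approx_cong)
    fix z assume "z \<in> K"
    then have "norm z = 1" using K(2) by auto
    then have "z * cnj z = 1" "z \<noteq> 0" by (auto simp flip: complex_norm_square)
    then show "1 / (z - 0) = cnj z" by (simp add: field_simps)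
  qed
  have Re: "poly_approx K (\<lambda>z. of_real (Re z))"
  proof (rule poly_approx_cong)
    show "poly_approx K (\<lambda>z. (1/2) * (z + cnj z))"
      by (intro poly_approx_mult poly_approx_add K z iz poly_approx_const)
  qed (simp add: complex_eq_iff)
  have Im: "poly_approx K (\<lambda>z. of_real (Im z))"
  proof (rule poly_approx_cong)
    show "poly_approx K (\<lambda>z. (-\<i>/2) * (z + (-1) * cnj z))"
      by (intro poly_approx_mult poly_approx_add K z iz poly_approx_const)
  qed (simp add: complex_eq_iff)
  have rp: "poly_approx K (\<lambda>z. of_real (f z))" if "real_polynomial_function f" for f
    using that
  proof (induction f rule: real_polynomial_function.induct)
    case (linear f)
    have eq: "of_real (Re z) * complex_of_real (f 1) + of_real (Im z) * of_real (f \<i>) = of_real (f z)" for z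
    proof -
      have "z = Re z *\<^sub>R 1 + Im z *\<^sub>R \<i>" by (simp add: complex_eq_iff)
      then have "f z = f (Re z *\<^sub>R 1 + Im z *\<^sub>R \<i>)" by (rule arg_cong)
      also have "\<dots> = Re z * f 1 + Im z * f \<i>"
        using linear by (simp only: linear_add linear_scale bounded_linear.linear real_scaleR_def)
      finally show ?thesis by simp
    qed
    have "poly_approx K (\<lambda>z. of_real (Re z) * complex_of_real (f 1) + of_real (Im z) * of_real (f \<i>))"
      by (intro poly_approx_mult poly_approx_add K Re Im poly_approx_const)
    then show ?case unfolding eq .
  qed (auto intro: poly_approx_const poly_approx_add poly_approx_mult K)
  show ?thesis
  proof (rule poly_approx_limit)
    fix e :: real assume "e > 0"
    from Stone_Weierstrass_polynomial_function[OF K(1) \<phi> this]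
    obtain g where g: "polynomial_function g" "\<forall>x\<in>K. norm (\<phi> x - g x) < e" by blast
    have "real_polynomial_function (Re \<circ> g)" "real_polynomial_function (Im \<circ> g)"
      using g(1) bounded_linear_Re bounded_linear_Im unfolding polynomial_function_def by auto
    then have "poly_approx K (\<lambda>z. of_real ((Re \<circ> g) z) + \<i> * of_real ((Im \<circ> g) z))"
      by (intro poly_approx_mult poly_approx_add K poly_approx_const rp)
    then have "poly_approx K g"
      by (rule poly_approx_cong) (simp add: complex_eq_iff)
    with g show "\<exists>h. poly_approx K h \<and> (\<forall>z\<in>K. norm (\<phi> z - h z) < e)" by blast
  qed
qed

section \<open>Countable data, caps and a single correction\<close>

text \<open>Coefficients are replaced by nearby ones from a countable dense set, one Horner step at
  a time; on the closed unit disc the factor \<open>z\<close> does not enlarge the earlier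
  error.\<close>

lemma countable_dense_polys:
  obtains Q :: "complex poly set" where "countable Q" "Q \<noteq> {}"
    "\<And>p e. e > 0 \<Longrightarrow> \<exists>q\<in>Q. \<forall>z\<in>cball 0 1. norm (poly p z - poly q z) < e"
proof -
  obtain D :: "complex set" where D: "countable D" "\<And>X. open X \<Longrightarrow> X \<noteq> {} \<Longrightarrow> \<exists>d\<in>D. d \<in> X"
    using countable_dense_setE by metis
  define Q where "Q = Poly ` lists D"
  have "countable Q" unfolding Q_def using D(1) by (intro countable_image countable_lists)
  moreover have "Q \<noteq> {}" by (auto simp: Q_def lists.Nil)
  moreover have "\<exists>q\<in>Q. \<forall>z\<in>cball 0 1. norm (poly p z - poly q z) < e" if "e > 0" for p e
    using that
  proof (induction p arbitrary: e)
    case 0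
    have "0 \<in> Q" unfolding Q_def by (metis Poly.simps(1) image_eqI lists.Nil)
    with 0 show ?case by (intro bexI[of _ 0]) auto
  next
    case (pCons a p)
    then obtain q where q: "q \<in> Q" "\<forall>z\<in>cball 0 1. norm (poly p z - poly q z) < e/2"
      by (meson half_gt_zero)
    then obtain xs where xs: "xs \<in> lists D" "q = Poly xs" by (auto simp: Q_def)
    obtain d where d: "d \<in> D" "norm (a - d) < e/2"
      using D(2)[of "ball a (e/2)"] pCons.prems by (auto simp: dist_norm)
    have "pCons d q \<in> Q" unfolding Q_def xs(2)
      using d xs by (intro image_eqI[of _ _ "d # xs"]) auto
    moreover have "norm (poly (pCons a p) z - poly (pCons d q) z) < e" if z: "z \<in> cball 0 1" for z
    proof -
      have "poly (pCons a p) z - poly (pCons d q) z = (a - d) + z * (poly p z - poly q z)"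
        by (simp add: algebra_simps)
      also have "norm \<dots> \<le> norm (a - d) + norm z * norm (poly p z - poly q z)"
        by (metis norm_mult norm_triangle_ineq)
      also have "\<dots> \<le> norm (a - d) + 1 * norm (poly p z - poly q z)"
        using z by (intro add_left_mono mult_right_mono) auto
      also have "\<dots> < e" using d(2) q(2) z by fastforce
      finally show ?thesis .
    qed
    ultimately show ?case by blast
  qed
  ultimately show ?thesis using that by blast
qed

text \<open>Each target has to recur at arbitrarily late stages of the construction, where the
  tolerances are small.\<close>

lemma infinitely_often_enumeration:
  assumes "countable X" "X \<noteq> {}"
  shows "\<exists>E :: nat \<Rightarrow> 'a. range E \<subseteq> X \<and> (\<forall>x\<in>X. \<forall>N. \<exists>j\<ge>N. E j = x)"
proof -
  define E where "E j = from_nat_into X (fst (prod_decode j))" for j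
  have "range E \<subseteq> X" using from_nat_into[OF assms(2)] by (auto simp: E_def)
  moreover have "\<exists>j\<ge>N. E j = x" if "x \<in> X" for x N
  proof -
    obtain i where "from_nat_into X i = x" using assms(1) \<open>x \<in> X\<close> by (metis from_nat_into_surj)
    then show ?thesis
      by (intro exI[of _ "prod_encode (i, N)"]) (auto simp: E_def le_prod_encode_2)
  qed
  ultimately show ?thesis by blast
qed

text \<open>Among the points of the closed disc only \<xi> has inner product \<open>1\<close> with
  \<xi>, and compactness turns this into a gap. So a small enough cap at \<xi> misses
  \<open>K\<close>.\<close>

lemma inner_le_off_compact:
  fixes \<xi> :: complex
  assumes "norm \<xi> = 1" "compact K" "K \<subseteq> cball 0 1" "\<xi> \<notin> K"
  obtains \<eta> where "\<eta> > 0" "\<And>z. z \<in> K \<Longrightarrow> \<xi> \<bullet> z \<le> 1 - \<eta>"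
proof -
  have lt: "\<xi> \<bullet> z < 1" if "z \<in> K" for z
  proof -
    have "norm z \<le> 1" "z \<noteq> \<xi>" using that assms by auto
    have "0 < (norm (\<xi> - z))\<^sup>2" using \<open>z \<noteq> \<xi>\<close> by simp
    also have "\<dots> = 1 + (norm z)\<^sup>2 - 2 * (\<xi> \<bullet> z)"
      using assms(1) by (simp add: power2_norm_eq_inner inner_diff inner_commute algebra_simps norm_eq_1)
    also have "\<dots> \<le> 1 + 1 - 2 * (\<xi> \<bullet> z)" using \<open>norm z \<le> 1\<close> by (simp add: power_le_one)
    finally show ?thesis by simp
  qed
  have "compact ((\<lambda>z. \<xi> \<bullet> z) ` K)"
    by (intro compact_continuous_image continuous_intros assms)
  then have "open (- (\<lambda>z. \<xi> \<bullet> z) ` K)" by (simp add: compact_imp_closed open_Compl)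
  moreover have "1 \<in> - (\<lambda>z. \<xi> \<bullet> z) ` K" using lt by force
  ultimately obtain e where e: "e > 0" "ball 1 e \<subseteq> - (\<lambda>z. \<xi> \<bullet> z) ` K"
    by (meson open_contains_ball)
  have "\<xi> \<bullet> z \<le> 1 - e" if "z \<in> K" for z
  proof -
    have "\<xi> \<bullet> z \<notin> ball 1 e" using e that by auto
    then show ?thesis using lt[OF that] by (auto simp: dist_real_def)
  qed
  with e(1) show ?thesis using that by blast
qed

text \<open>The increments from stage \<open>n\<close> on sum to at most
  \<open>(1/2) ^ (n + 1)\<close>. The start \<open>N\<close> serves points where the increments are
  controlled only from some stage on.\<close>

lemma geometric_Cauchy_limit:
  fixes a :: "nat \<Rightarrow> complex"
  assumes a: "\<And>n. N \<le> n \<Longrightarrow> norm (a (Suc n) - a n) \<le> (1/2) ^ (n + 2)" and n: "N \<le> n"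
  shows "norm (lim a - a n) \<le> (1/2) ^ (n + 1)"
proof -
  \<comment> \<open>Keeping the subtracted term makes the estimate inductive.\<close>
  have bd: "norm (a (k + m) - a k) \<le> (1/2) ^ (k + 1) - (1/2) ^ (k + m + 1)" if "N \<le> k" for k m
  proof (induction m)
    case (Suc m)
    have "norm (a (k + Suc m) - a k) \<le> norm (a (Suc (k + m)) - a (k + m)) + norm (a (k + m) - a k)"
      by (metis add_Suc_right norm_triangle_ineq diff_add_cancel add_diff_eq)
    also have "\<dots> \<le> (1/2) ^ (k + m + 2) + ((1/2) ^ (k + 1) - (1/2) ^ (k + m + 1))"
      using Suc a[of "k + m"] that by (intro add_mono) auto
    also have "\<dots> = (1/2) ^ (k + 1) - (1/2) ^ (k + Suc m + 1)" by (simp add: field_simps)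
    finally show ?case .
  qed simp
  have bd': "norm (a l - a k) \<le> (1/2) ^ (k + 1)" if "N \<le> k" "k \<le> l" for k l
  proof -
    have "norm (a (k + (l - k)) - a k) \<le> (1/2) ^ (k + 1) - (1/2) ^ (k + (l - k) + 1)"
      by (rule bd[OF that(1)])
    moreover have "(1/2::real) ^ (k + (l - k) + 1) \<ge> 0" by simp
    moreover have "k + (l - k) = l" using that(2) by simp
    ultimately show ?thesis unfolding \<open>k + (l - k) = l\<close> by linarith
  qed
  have "Cauchy a"
  proof (rule CauchyI')
    fix e :: real assume "e > 0"
    then obtain M where M: "(1/2::real) ^ M < e" using real_arch_pow_inv[OF \<open>e > 0\<close>, of "1/2"] by force
    show "\<exists>M. \<forall>m\<ge>M. \<forall>n>m. dist (a m) (a n) < e"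
    proof (intro exI[of _ "max M N"] allI impI)
      fix m n assume *: "max M N \<le> m" "m < n"
      have "norm (a m - a n) \<le> (1/2) ^ (m + 1)" using bd'[of m n] * by (simp add: norm_minus_commute)
      also have "\<dots> \<le> (1/2) ^ M" using * by (intro power_decreasing) auto
      finally show "dist (a m) (a n) < e" using M by (simp add: dist_norm)
    qed
  qed
  then have "a \<longlonglongrightarrow> lim a" by (simp add: Cauchy_convergent_iff convergent_LIMSEQ_iff)
  then have "(\<lambda>l. norm (a l - a n)) \<longlonglongrightarrow> norm (lim a - a n)" by (intro tendsto_intros)
  then show ?thesis
    by (rule LIMSEQ_le_const2) (use bd' n in auto)
qed

text \<open>The correction added to \<open>p\<close> is close to \<open>0\<close> on the slit disc
  off the annulus and close to the rescaled \<open>q\<close> minus \<open>p\<close> on the circle of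
  radius \<open>r m\<close>. For late \<open>m\<close> the annulus lies outside the disc of radius
  \<open>1 - h\<close>, so earlier work is kept.\<close>

lemma universal_step:
  fixes p q :: "complex poly"
  assumes r: "admissible_radii r" and \<Gamma>: "compact \<Gamma>" "\<Gamma> \<subseteq> cball 0 1" and \<xi>: "\<xi> \<in> sphere 0 1 - \<Gamma>"
    and \<delta>: "\<And>n. \<delta> n > 0" "\<delta> \<longlonglongrightarrow> 0" and h: "h > 0" and e: "e > 0"
  shows "\<exists>m p'. N \<le> m \<and> (\<forall>z\<in>cball 0 (1 - h). norm (poly p' z - poly p z) \<le> e) \<and>
    (\<forall>z\<in>\<Gamma>. \<delta> m \<le> \<bar>norm z - r m\<bar> \<longrightarrow> norm (poly p' z - poly p z) \<le> e) \<and>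
    (\<forall>z\<in>sphere 0 1. \<xi> \<bullet> z \<le> 1 - h \<longrightarrow> norm (poly p' (of_real (r m) * z) - poly q z) \<le> e)"
proof -
  have n\<xi>: "norm \<xi> = 1" and "\<xi> \<notin> \<Gamma>" using \<xi> by auto
  then obtain \<eta>0 where \<eta>0: "\<eta>0 > 0" "\<And>z. z \<in> \<Gamma> \<Longrightarrow> \<xi> \<bullet> z \<le> 1 - \<eta>0"
    using inner_le_off_compact \<Gamma> by metis
  \<comment> \<open>The cap has to lie within the part where nothing is demanded of the target
    (\<open>h\<close>) and to miss \<Gamma> (\<open>\<eta>0\<close>); \<open>1/2\<close> keeps
    \<eta> below \<open>1\<close>.\<close>
  define \<eta> where "\<eta> = min (min h \<eta>0) (1/2)"
  have \<eta>: "0 < \<eta>" "\<eta> < 1" "\<eta> \<le> h" "\<eta> \<le> \<eta>0" using h \<eta>0 by (auto simp: \<eta>_def)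
  have r1: "r n < 1" for n using r by (simp add: admissible_radii_def)
  have "(\<lambda>n. r n - \<delta> n) \<longlonglongrightarrow> 1 - 0" using r \<delta>(2) by (intro tendsto_diff) (auto simp: admissible_radii_def)
  then have "eventually (\<lambda>n. 1 - \<eta> < r n - \<delta> n) sequentially"
    using \<eta> by (intro order_tendstoD) auto
  then have "eventually (\<lambda>n. 1 - \<eta> < r n - \<delta> n \<and> N \<le> n) sequentially"
    using eventually_ge_at_top by (rule eventually_conj)
  then obtain m where m: "1 - \<eta> < r m - \<delta> m" "N \<le> m" by (auto simp: eventually_sequentially)
  define \<rho> where "\<rho> = r m"
  have \<rho>: "0 < \<rho>" "\<rho> < 1" "1 - \<eta> < \<rho>" using m(1) \<delta>(1)[of m] \<eta> r1[of m] by (auto simp: \<rho>_def)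
  define L where "L = {z. norm z \<le> 1 \<and> \<xi> \<bullet> z \<le> 1 - \<eta> \<and> (norm z \<le> \<rho> - \<delta> m \<or> norm z = \<rho> \<or> \<rho> + \<delta> m \<le> norm z)}"
  \<comment> \<open>\<open>q\<close> is rescaled from the unit circle to radius \<rho>, and what
    \<open>p\<close> already contributes is subtracted.\<close>
  define q' where "q' = pcompose q [:0, 1 / of_real \<rho>:] - p"
  have "poly_approx L (\<lambda>z. if norm z = \<rho> then poly q' z else 0)"
    unfolding L_def using \<eta> m r1[of m] by (intro poly_approx_slit_disc_minus_annulus n\<xi> \<delta>) (auto simp: \<rho>_def)
  then obtain P where P: "\<And>z. z \<in> L \<Longrightarrow> norm ((if norm z = \<rho> then poly q' z else 0) - poly P z) < e"
    using poly_approxE[OF _ e] by blast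
  have "norm (poly (p + P) z - poly p z) \<le> e" if "z \<in> cball 0 (1 - h)" for z
  proof -
    have z: "norm z \<le> 1 - h" using that by simp
    then have "\<xi> \<bullet> z \<le> 1 - h" using norm_cauchy_schwarz[of \<xi> z] n\<xi> by simp
    then have "z \<in> L" "norm z \<noteq> \<rho>" using z \<eta> m(1) \<rho> h by (auto simp: L_def \<rho>_def)
    then show ?thesis using P[of z] by simp
  qed
  moreover have "norm (poly (p + P) z - poly p z) \<le> e" if "z \<in> \<Gamma>" "\<delta> m \<le> \<bar>norm z - r m\<bar>" for z
  proof -
    have "norm z \<noteq> \<rho>" using that(2) \<delta>(1)[of m] by (auto simp: \<rho>_def)
    moreover have "z \<in> L" using \<eta>0(2)[OF that(1)] \<eta> that \<Gamma> by (auto simp: L_def \<rho>_def)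
    ultimately show ?thesis using P[of z] by simp
  qed
  moreover have "norm (poly (p + P) (of_real (r m) * z) - poly q z) \<le> e"
    if "z \<in> sphere 0 1" "\<xi> \<bullet> z \<le> 1 - h" for z
  proof -
    define w where "w = of_real \<rho> * z"
    have "\<xi> \<bullet> w = \<rho> * (\<xi> \<bullet> z)" by (simp add: w_def scaleR_conv_of_real[symmetric])
    also have "\<dots> \<le> 1 - \<eta>"
    \<comment> \<open>Multiplying by \<rho> decreases the inner product only if it is positive;
      otherwise the product is at most \<open>0\<close>, which is below
      \<open>1 - \<eta>\<close>.\<close>
    proof (cases "\<xi> \<bullet> z \<le> 0")
      case True
      then have "\<rho> * (\<xi> \<bullet> z) \<le> 0" using \<rho> by (simp add: mult_nonneg_nonpos)
      then show ?thesis using \<eta> by simp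
    next
      case False
      then have "\<rho> * (\<xi> \<bullet> z) \<le> 1 * (\<xi> \<bullet> z)" using \<rho> by (intro mult_right_mono) auto
      then show ?thesis using \<eta> that by simp
    qed
    finally have "\<xi> \<bullet> w \<le> 1 - \<eta>" .
    moreover have "norm w = \<rho>" using \<rho> that by (simp add: w_def norm_mult)
    ultimately have "norm (poly q' w - poly P w) < e" using P[of w] \<rho> by (simp add: L_def)
    moreover have "poly q' w = poly q z - poly p w"
      using \<rho> by (simp add: q'_def poly_pcompose w_def)
    ultimately show ?thesis unfolding \<rho>_def[symmetric] w_def[symmetric]
      by (simp add: norm_minus_commute algebra_simps)
  qed
  ultimately show ?thesis using m(2) by blast
qed

section \<open>Construction of Abel universal functions\<close>

text \<open>The increasing indices are picked one after the other, with tolerance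
  \<open>inverse (Suc k)\<close> at step \<open>k\<close>.\<close>

lemma Abel_universal_wrtI:
  fixes f :: "complex \<Rightarrow> complex"
  assumes "f holomorphic_on ball 0 1"
    and *: "\<And>K (\<phi> :: complex \<Rightarrow> complex) e N. compact K \<Longrightarrow> K \<subseteq> sphere 0 1 \<Longrightarrow> K \<noteq> sphere 0 1 \<Longrightarrow> continuous_on K \<phi> \<Longrightarrow> e > 0 \<Longrightarrow>
      \<exists>n\<ge>N. \<forall>\<zeta>\<in>K. norm (f (of_real (r n) * \<zeta>) - \<phi> \<zeta>) < e"
  shows "f \<in> Abel_universal_wrt r"
  unfolding Abel_universal_wrt_def
proof (intro CollectI conjI allI impI assms(1))
  fix K and \<phi> :: "complex \<Rightarrow> complex" assume K: "compact K" "K \<subseteq> sphere 0 1" "K \<noteq> sphere 0 1" "continuous_on K \<phi>"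
  have "\<exists>n. \<forall>k. (\<forall>\<zeta>\<in>K. norm (f (of_real (r (n k)) * \<zeta>) - \<phi> \<zeta>) < inverse (real (Suc k))) \<and> n k < n (Suc k)"
  proof (rule dependent_nat_choice)
    show "\<exists>n. \<forall>\<zeta>\<in>K. norm (f (of_real (r n) * \<zeta>) - \<phi> \<zeta>) < inverse (real (Suc 0))"
      using *[OF K, of 1 0] by auto
    fix n k
    have "inverse (real (Suc (Suc k))) > 0" by simp
    from *[OF K this, of "Suc n"]
    show "\<exists>n'. (\<forall>\<zeta>\<in>K. norm (f (of_real (r n') * \<zeta>) - \<phi> \<zeta>) < inverse (real (Suc (Suc k)))) \<and> n < n'"
      by (meson Suc_le_eq)
  qed
  then obtain n where n: "\<And>k \<zeta>. \<zeta> \<in> K \<Longrightarrow> norm (f (of_real (r (n k)) * \<zeta>) - \<phi> \<zeta>) < inverse (real (Suc k))"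
    "\<And>k. n k < n (Suc k)" by blast
  have "uniform_limit K (\<lambda>k \<zeta>. f (of_real (r (n k)) * \<zeta>)) \<phi> sequentially"
  proof (rule uniform_limitI)
    fix e :: real assume "e > 0"
    then have "\<forall>\<^sub>F k in sequentially. inverse (real (Suc k)) < e"
      using LIMSEQ_inverse_real_of_nat by (intro order_tendstoD)
    then show "\<forall>\<^sub>F k in sequentially. \<forall>\<zeta>\<in>K. dist (f (of_real (r (n k)) * \<zeta>)) (\<phi> \<zeta>) < e"
    proof eventually_elim
      case (elim k)
      show ?case using n(1)[of _ k] elim by (metis dist_norm less_trans)
    qed
  qed
  moreover have "strict_mono n" using n(2) by (simp add: strict_mono_Suc_iff)
  ultimately show "\<exists>n :: nat \<Rightarrow> nat. strict_mono n \<and>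
      uniform_limit K (\<lambda>k \<zeta>. f (of_real (r (n k)) * \<zeta>)) \<phi> sequentially" by blast
qed

lemma islimpt_circle:
  fixes z :: complex
  assumes "z \<in> sphere 0 1"
  shows "z islimpt sphere 0 1"
proof (rule connected_imp_perfect[OF _ assms])
  show "connected (sphere (0::complex) 1)" by (rule connected_sphere) simp
  have "1 \<in> sphere (0::complex) 1" "-1 \<in> sphere (0::complex) 1" by auto
  then show "sphere (0::complex) 1 \<noteq> {x}" for x by (metis one_neq_neg_one singletonD)
qed

text \<open>The radii \<open>s\<close> come from an unknown sequence, and their convergence to
  \<open>1\<close> is what can be exploited. On a finite set every assignment of values is
  continuous, so \<phi> is arbitrary.\<close>

lemma Abel_universal_finite_set:
  assumes h: "h \<in> Abel_universal" and K: "finite K" "K \<subseteq> sphere 0 1"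
  obtains s :: "nat \<Rightarrow> real" where "\<And>k. s k \<in> {0..<1}" "s \<longlonglongrightarrow> 1"
    "\<And>\<zeta>. \<zeta> \<in> K \<Longrightarrow> (\<lambda>k. h (of_real (s k) * \<zeta>)) \<longlonglongrightarrow> \<phi> \<zeta>"
proof -
  obtain r where r: "admissible_radii r" "h \<in> Abel_universal_wrt r"
    using h by (auto simp: Abel_universal_def)
  have "infinite (sphere (0::complex) 1)"
    using islimpt_circle[of 1] islimpt_finite by auto
  then have "K \<noteq> sphere 0 1" using K(1) by blast
  then obtain n :: "nat \<Rightarrow> nat" where n: "strict_mono n"
    "uniform_limit K (\<lambda>k \<zeta>. h (of_real (r (n k)) * \<zeta>)) \<phi> sequentially"
  proof -
    have "compact K" "continuous_on K \<phi>"
      using K(1) by (auto simp: finite_imp_compact finite_imp_closed intro: continuous_on_finite)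
    then have "\<exists>n :: nat \<Rightarrow> nat. strict_mono n \<and>
        uniform_limit K (\<lambda>k \<zeta>. h (of_real (r (n k)) * \<zeta>)) \<phi> sequentially"
      using r(2) K(2) \<open>K \<noteq> sphere 0 1\<close> unfolding Abel_universal_wrt_def by simp
    then show ?thesis using that by blast
  qed
  show ?thesis
  proof (rule that[of "r \<circ> n"])
    show "(r \<circ> n) k \<in> {0..<1}" for k using r(1) by (auto simp: admissible_radii_def)
    show "(r \<circ> n) \<longlonglongrightarrow> 1"
      using r(1) n(1) LIMSEQ_subseq_LIMSEQ by (auto simp: admissible_radii_def)
    show "(\<lambda>k. h (of_real ((r \<circ> n) k) * \<zeta>)) \<longlonglongrightarrow> \<phi> \<zeta>" if "\<zeta> \<in> K" for \<zeta>
      using tendsto_uniform_limitI[OF n(2) that] by simp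
  qed
qed

text \<open>A gap condition on the radii used (\<open>g\<close>) and the thickness of the annuli (\<open>\<delta>\<close>) can be prescribed:
  near the circle of radius \<open>r (m (Suc n))\<close> the \<open>n\<close>-th correction moves the function towards the
  \<open>n\<close>-th target, and it is tiny on the rest of \<open>\<Gamma>\<close>.\<close>

theorem Abel_universal_small_off_annuli:
  fixes \<delta> :: "nat \<Rightarrow> real" and g :: "nat \<Rightarrow> nat"
  assumes r: "admissible_radii r" and \<Gamma>: "compact \<Gamma>" "\<Gamma> \<subseteq> cball 0 1"
    and dense: "sphere 0 1 \<subseteq> closure (sphere 0 1 - \<Gamma>)"
    and \<delta>: "\<And>n. \<delta> n > 0" "\<delta> \<longlonglongrightarrow> 0"
  obtains f m where "f \<in> Abel_universal_wrt r" "strict_mono m" "\<And>j. g (m j) \<le> m (Suc j)"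
    "\<And>z. z \<in> \<Gamma> \<Longrightarrow> norm z < 1 \<Longrightarrow> (\<And>j. \<delta> (m j) \<le> \<bar>norm z - r (m j)\<bar>) \<Longrightarrow> norm (f z) \<le> 1"
proof -
  \<comment> \<open>The cap centres: off \<Gamma>, so that small caps miss it, yet dense in the
    circle, so that some centre lies outside any given proper compact \<open>K\<close>.\<close>
  obtain \<Xi> where \<Xi>: "countable \<Xi>" "\<Xi> \<subseteq> sphere 0 1 - \<Gamma>" "sphere 0 1 - \<Gamma> \<subseteq> closure \<Xi>"
    using separable by blast
  then have \<Xi>_dense: "sphere 0 1 \<subseteq> closure \<Xi>" using dense by (meson closure_minimal closed_closure order_trans)
  obtain Q :: "complex poly set" where Q: "countable Q" "Q \<noteq> {}"
    "\<And>p e. e > 0 \<Longrightarrow> \<exists>q\<in>Q. \<forall>z\<in>cball 0 1. norm (poly p z - poly q z) < e"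
    using countable_dense_polys by metis
  have "(1::complex) \<in> closure \<Xi>" using \<Xi>_dense by auto
  then have "\<Xi> \<noteq> {}" by auto
  then have QX: "countable (Q \<times> \<Xi>)" "Q \<times> \<Xi> \<noteq> {}" using Q(1,2) \<Xi>(1) by auto
  obtain E :: "nat \<Rightarrow> complex poly \<times> complex" where E: "range E \<subseteq> Q \<times> \<Xi>" "\<And>x N. x \<in> Q \<times> \<Xi> \<Longrightarrow> \<exists>j\<ge>N. E j = x"
    using infinitely_often_enumeration[OF QX] by metis
  have r1: "r n < 1" "0 \<le> r n" for n using r by (auto simp: admissible_radii_def)
  have rmono: "r i \<le> r j" if "i \<le> j" for i j using r that by (auto simp: admissible_radii_def incseq_def)
  \<comment> \<open>\<open>1 / Suc n\<close> shrinks the caps and makes the discs of radius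
    \<open>1 - h\<close> exhaust the unit disc; \<open>1 - r m\<close> makes them contain the circle
    of radius \<open>r m\<close>, so later corrections hardly disturb what was achieved
    there.\<close>
  define h where "h n m = min (1 / real (Suc n)) (1 - r m)" for n m
  have h: "h n m > 0" for n m using r1[of m] by (simp add: h_def)
  \<comment> \<open>The state is a polynomial together with the index of the latest radius; the
    index at stage \<open>0\<close> is arbitrary and belongs to no correction.\<close>
  have "\<exists>S. \<forall>n. (n = 0 \<longrightarrow> fst (S n) = 0) \<and>
      (max (Suc (snd (S n))) (g (snd (S n))) \<le> snd (S (Suc n)) \<and>
       (\<forall>z\<in>cball 0 (1 - h n (snd (S n))). norm (poly (fst (S (Suc n))) z - poly (fst (S n)) z) \<le> (1/2) ^ (n + 2)) \<and>
       (\<forall>z\<in>\<Gamma>. \<delta> (snd (S (Suc n))) \<le> \<bar>norm z - r (snd (S (Suc n)))\<bar> \<longrightarrow>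
          norm (poly (fst (S (Suc n))) z - poly (fst (S n)) z) \<le> (1/2) ^ (n + 2)) \<and>
       (\<forall>z\<in>sphere 0 1. snd (E n) \<bullet> z \<le> 1 - h n (snd (S n)) \<longrightarrow>
          norm (poly (fst (S (Suc n))) (of_real (r (snd (S (Suc n)))) * z) - poly (fst (E n)) z) \<le> (1/2) ^ (n + 2)))"
  proof (rule dependent_nat_choice)
    show "\<exists>x. 0 = 0 \<longrightarrow> fst x = (0 :: complex poly)" by (metis fst_conv)
    fix x :: "complex poly \<times> nat" and n
    have \<xi>: "snd (E n) \<in> sphere 0 1 - \<Gamma>" 
    proof -
      have "E n \<in> Q \<times> \<Xi>" using E(1) by blast
      then show ?thesis using \<Xi>(2) by (auto simp: mem_Times_iff)
    qed
    have "(1/2::real) ^ (n + 2) > 0" by simp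
    from universal_step[OF r \<Gamma> \<xi> \<delta> h[of n "snd x"] this, of "max (Suc (snd x)) (g (snd x))" "fst x" "fst (E n)"]
    obtain m p' where "max (Suc (snd x)) (g (snd x)) \<le> m"
       "(\<forall>z\<in>cball 0 (1 - h n (snd x)). norm (poly p' z - poly (fst x) z) \<le> (1/2) ^ (n + 2))"
       "(\<forall>z\<in>\<Gamma>. \<delta> m \<le> \<bar>norm z - r m\<bar> \<longrightarrow> norm (poly p' z - poly (fst x) z) \<le> (1/2) ^ (n + 2))"
       "(\<forall>z\<in>sphere 0 1. snd (E n) \<bullet> z \<le> 1 - h n (snd x) \<longrightarrow>
          norm (poly p' (of_real (r m) * z) - poly (fst (E n)) z) \<le> (1/2) ^ (n + 2))"
      by blast
    then show "\<exists>y. (Suc n = 0 \<longrightarrow> fst y = 0) \<and> max (Suc (snd x)) (g (snd x)) \<le> snd y \<and>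
       (\<forall>z\<in>cball 0 (1 - h n (snd x)). norm (poly (fst y) z - poly (fst x) z) \<le> (1/2) ^ (n + 2)) \<and>
       (\<forall>z\<in>\<Gamma>. \<delta> (snd y) \<le> \<bar>norm z - r (snd y)\<bar> \<longrightarrow> norm (poly (fst y) z - poly (fst x) z) \<le> (1/2) ^ (n + 2)) \<and>
       (\<forall>z\<in>sphere 0 1. snd (E n) \<bullet> z \<le> 1 - h n (snd x) \<longrightarrow>
          norm (poly (fst y) (of_real (r (snd y)) * z) - poly (fst (E n)) z) \<le> (1/2) ^ (n + 2))"
      by (intro exI[of _ "(p', m)"]) simp
  qed
  then obtain S where S0: "fst (S 0) = 0" and
    Sm: "\<And>n. max (Suc (snd (S n))) (g (snd (S n))) \<le> snd (S (Suc n))" and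
    Sa: "\<And>n z. z \<in> cball 0 (1 - h n (snd (S n))) \<Longrightarrow> norm (poly (fst (S (Suc n))) z - poly (fst (S n)) z) \<le> (1/2) ^ (n + 2)" and
    Sb: "\<And>n z. z \<in> \<Gamma> \<Longrightarrow> \<delta> (snd (S (Suc n))) \<le> \<bar>norm z - r (snd (S (Suc n)))\<bar> \<Longrightarrow>
          norm (poly (fst (S (Suc n))) z - poly (fst (S n)) z) \<le> (1/2) ^ (n + 2)" and
    Sc: "\<And>n z. z \<in> sphere 0 1 \<Longrightarrow> snd (E n) \<bullet> z \<le> 1 - h n (snd (S n)) \<Longrightarrow>
          norm (poly (fst (S (Suc n))) (of_real (r (snd (S (Suc n)))) * z) - poly (fst (E n)) z) \<le> (1/2) ^ (n + 2)"
    by metis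
  define p where "p n = fst (S n)" for n
  define \<mu> where "\<mu> n = snd (S n)" for n
  define f where "f z = lim (\<lambda>n. poly (p n) z)" for z
  have \<mu>: "strict_mono \<mu>" unfolding strict_mono_Suc_iff \<mu>_def using Sm by (simp add: Suc_le_eq)
  have fp: "norm (f z - poly (p n) z) \<le> (1/2) ^ (n + 1)"
    if "N \<le> n" "\<And>n. N \<le> n \<Longrightarrow> z \<in> cball 0 (1 - h n (\<mu> n))" for z n N
    unfolding f_def using that(2) Sa
    by (intro geometric_Cauchy_limit[OF _ that(1)]) (auto simp: p_def \<mu>_def)
  have hol: "f holomorphic_on ball 0 1"
  proof (rule holomorphic_uniform_sequence)
    show "(poly (p n)) holomorphic_on ball 0 1" for n by (intro holomorphic_intros)
    fix x :: complex assume "x \<in> ball 0 1"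
    then have x: "norm x < 1" by simp
    define d where "d = (1 - norm x) / 2"
    have d: "d > 0" "norm x + d < 1" using x by (auto simp: d_def field_simps)
    have sub: "norm z \<le> norm x + d" if "z \<in> cball x d" for z
      using that norm_triangle_ineq[of x "z - x"] by (simp add: dist_norm norm_minus_commute)
    have "(\<lambda>n. inverse (real (Suc n))) \<longlonglongrightarrow> 0" by (rule LIMSEQ_inverse_real_of_nat)
    then have "\<forall>\<^sub>F n in sequentially. inverse (real (Suc n)) < 1 - (norm x + d)"
      using d by (intro order_tendstoD) auto
    then obtain N where N: "\<And>n. N \<le> n \<Longrightarrow> inverse (real (Suc n)) < 1 - (norm x + d)"
      by (auto simp: eventually_sequentially)
    have inb: "z \<in> cball 0 (1 - h n (\<mu> n))" if "z \<in> cball x d" "N \<le> n" for z n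
    proof -
      have "h n (\<mu> n) \<le> inverse (real (Suc n))" by (simp add: h_def field_simps)
      then show ?thesis using N[OF that(2)] sub[OF that(1)] by simp
    qed
    have "uniform_limit (cball x d) (\<lambda>n. poly (p n)) f sequentially"
    proof (rule uniform_limitI)
      fix e :: real assume e: "e > 0"
      obtain M where M: "(1/2::real) ^ M < e" using real_arch_pow_inv[OF e, of "1/2"] by force
      show "\<forall>\<^sub>F n in sequentially. \<forall>z\<in>cball x d. dist (poly (p n) z) (f z) < e"
        unfolding eventually_sequentially
      proof (intro exI[of _ "max M N"] allI impI ballI)
        fix n z assume *: "max M N \<le> n" "z \<in> cball x d"
        have "norm (f z - poly (p n) z) \<le> (1/2) ^ (n + 1)"
          using * inb by (intro fp[of N]) auto
        also have "\<dots> \<le> (1/2) ^ M" using * by (intro power_decreasing) auto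
        finally show "dist (poly (p n) z) (f z) < e" using M by (simp add: dist_norm norm_minus_commute)
      qed
    qed
    moreover have "cball x d \<subseteq> ball 0 1" using sub d by force
    ultimately show "\<exists>d>0. cball x d \<subseteq> ball 0 1 \<and> uniform_limit (cball x d) (\<lambda>n. poly (p n)) f sequentially"
      using d(1) by blast
  qed simp
  have approx: "norm (f (of_real (r (\<mu> (Suc n))) * z) - poly (fst (E n)) z) \<le> (1/2) ^ (n + 1)"
    if z: "z \<in> sphere 0 1" and hz: "snd (E n) \<bullet> z \<le> 1 - 1 / real (Suc n)" for n z
  proof -
    define w where "w = of_real (r (\<mu> (Suc n))) * z"
    have "norm w = r (\<mu> (Suc n))" using z r1 by (simp add: w_def norm_mult)
    \<comment> \<open>All later discs contain the circle of radius \<open>r (\<mu> (Suc n))\<close>,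
      so there \<open>f\<close> differs from \<open>p (Suc n)\<close> only by a geometric
      tail.\<close>
    then have "w \<in> cball 0 (1 - h k (\<mu> k))" if "Suc n \<le> k" for k
      using rmono[of "\<mu> (Suc n)" "\<mu> k"] strict_mono_less_eq[OF \<mu>] that by (simp add: h_def)
    then have "norm (f w - poly (p (Suc n)) w) \<le> (1/2) ^ (Suc n + 1)" by (rule fp[OF order_refl])
    moreover have "norm (poly (p (Suc n)) w - poly (fst (E n)) z) \<le> (1/2) ^ (n + 2)"
      unfolding p_def w_def \<mu>_def using hz by (intro Sc z) (auto simp: h_def)
    ultimately have "norm (f w - poly (fst (E n)) z) \<le> (1/2) ^ (Suc n + 1) + (1/2) ^ (n + 2)"
      using norm_triangle_ineq[of "f w - poly (p (Suc n)) w" "poly (p (Suc n)) w - poly (fst (E n)) z"] by simp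
    then show ?thesis by (simp add: w_def field_simps)
  qed
  have univ: "f \<in> Abel_universal_wrt r"
  proof (rule Abel_universal_wrtI[OF hol])
    fix K and \<phi> :: "complex \<Rightarrow> complex" and e :: real and N
    assume K: "compact K" "K \<subseteq> sphere 0 1" "K \<noteq> sphere 0 1" "continuous_on K \<phi>" and e: "e > 0"
    obtain \<xi>' where "\<xi>' \<in> sphere 0 1" "\<xi>' \<notin> K" using K by blast
    moreover have "open (- K)" using K(1) by (simp add: compact_imp_closed open_Compl)
    \<comment> \<open>\<open>K\<close> is closed and misses a circle point, hence an arc around it,
      and by density this arc contains a cap centre.\<close>
    ultimately obtain \<xi> where \<xi>: "\<xi> \<in> \<Xi>" "\<xi> \<notin> K"
      using \<Xi>_dense open_Int_closure_eq_empty[of "- K" \<Xi>] by blast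
    obtain \<eta> where \<eta>: "\<eta> > 0" "\<And>z. z \<in> K \<Longrightarrow> \<xi> \<bullet> z \<le> 1 - \<eta>"
    proof (rule inner_le_off_compact)
      show "norm \<xi> = 1" using \<xi>(1) \<Xi>(2) by auto
      show "K \<subseteq> cball 0 1" using K(2) sphere_cball by blast
    qed (use K \<xi> in auto)
    obtain P where P: "\<And>z. z \<in> K \<Longrightarrow> norm (\<phi> z - poly P z) < e/3"
      using poly_approxE[OF poly_approx_continuous_on_circle[OF K], of "e/3"] e by auto
    obtain q where q: "q \<in> Q" "\<forall>z\<in>cball 0 1. norm (poly P z - poly q z) < e/3" using Q(3)[of "e/3" P] e by auto
    have "(\<lambda>n. inverse (real (Suc n))) \<longlonglongrightarrow> 0" by (rule LIMSEQ_inverse_real_of_nat)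
    then have "\<forall>\<^sub>F n in sequentially. inverse (real (Suc n)) < \<eta>"
      using \<eta> by (intro order_tendstoD) auto
    then obtain N1 where N1: "\<And>n. N1 \<le> n \<Longrightarrow> inverse (real (Suc n)) < \<eta>"
      by (auto simp: eventually_sequentially)
    obtain M where M: "(1/2::real) ^ M < e/3" using real_arch_pow_inv[of "e/3" "1/2"] e by auto
    obtain n where n: "n \<ge> max N (max N1 M)" "E n = (q, \<xi>)" using E(2) q(1) \<xi>(1) by (metis SigmaI)
    have "norm (f (of_real (r (\<mu> (Suc n))) * \<zeta>) - \<phi> \<zeta>) < e" if \<zeta>: "\<zeta> \<in> K" for \<zeta>
    proof -
      have s: "\<zeta> \<in> sphere 0 1" using \<zeta> K by blast
      have "1 / real (Suc n) \<le> \<eta>" using N1[of n] n by (simp add: inverse_eq_divide)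
      then have "\<xi> \<bullet> \<zeta> \<le> 1 - 1 / real (Suc n)" using \<eta>(2)[OF \<zeta>] by linarith
      then have "norm (f (of_real (r (\<mu> (Suc n))) * \<zeta>) - poly q \<zeta>) \<le> (1/2) ^ (n + 1)"
        using approx[OF s, of n] n(2) by simp
      also have "\<dots> \<le> (1/2) ^ M" using n by (intro power_decreasing) auto
      finally have 1: "norm (f (of_real (r (\<mu> (Suc n))) * \<zeta>) - poly q \<zeta>) < e/3" using M by simp
      have 2: "norm (poly P \<zeta> - poly q \<zeta>) < e/3" using q(2) s by auto
      have "f (of_real (r (\<mu> (Suc n))) * \<zeta>) - \<phi> \<zeta> =
          (f (of_real (r (\<mu> (Suc n))) * \<zeta>) - poly q \<zeta>) - (poly P \<zeta> - poly q \<zeta>) - (\<phi> \<zeta> - poly P \<zeta>)" by simp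
      also have "norm \<dots> \<le> norm (f (of_real (r (\<mu> (Suc n))) * \<zeta>) - poly q \<zeta>) + norm (poly P \<zeta> - poly q \<zeta>) + norm (\<phi> \<zeta> - poly P \<zeta>)"
        by (meson add_right_mono norm_triangle_ineq4 order_trans)
      also have "\<dots> < e/3 + e/3 + e/3" by (intro add_strict_mono 1 2 P \<zeta>)
      finally show ?thesis by simp
    qed
    moreover have "N \<le> \<mu> (Suc n)"
      using n(1) strict_mono_imp_increasing[OF \<mu>, of "Suc n"] by linarith
    ultimately show "\<exists>n\<ge>N. \<forall>\<zeta>\<in>K. norm (f (of_real (r n) * \<zeta>) - \<phi> \<zeta>) < e" by blast
  qed
  show ?thesis
  \<comment> \<open>The shift skips \<open>\<mu> 0\<close>, which is not the radius index of a
    correction.\<close>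
  proof (rule that[of f "\<lambda>j. \<mu> (Suc j)"])
    show "strict_mono (\<lambda>j. \<mu> (Suc j))" using \<mu> by (simp add: strict_mono_Suc_iff)
    show "g (\<mu> (Suc j)) \<le> \<mu> (Suc (Suc j))" for j using Sm[of "Suc j"] by (simp add: \<mu>_def)
    show "norm (f z) \<le> 1" if z: "z \<in> \<Gamma>" "norm z < 1" "\<And>j. \<delta> (\<mu> (Suc j)) \<le> \<bar>norm z - r (\<mu> (Suc j))\<bar>" for z
    proof -
      \<comment> \<open>At such a point every correction is small from stage \<open>0\<close> on,
        and the construction starts at the zero polynomial.\<close>
      have "norm (f z - poly (p 0) z) \<le> (1/2) ^ (0 + 1)"
        unfolding f_def
        by (rule geometric_Cauchy_limit[where N = 0]) (use Sb[OF z(1)] z(3) in \<open>auto simp: p_def \<mu>_def\<close>)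
      then show ?thesis by (simp add: p_def S0)
    qed
  qed (rule univ)
qed

text \<open>This is the case of empty \<Gamma>; any null sequence of thicknesses serves.\<close>

lemma Abel_universal_wrt_nonempty:
  assumes "admissible_radii r"
  obtains f where "f \<in> Abel_universal_wrt r"
proof -
  have d: "(\<lambda>n. inverse (real (Suc n))) \<longlonglongrightarrow> 0" by (rule LIMSEQ_inverse_real_of_nat)
  show ?thesis
    by (rule Abel_universal_small_off_annuli[OF assms, of "{}" "\<lambda>n. inverse (real (Suc n))" id])
      (use d that in \<open>auto simp: closure_subset\<close>)
qed

section \<open>Self-maps of the disc that are unimodular on the circle\<close>

text \<open>A rotation maps each circle about \<open>0\<close> to itself, so the target on
  \<open>K\<close> is transported to the rotated set and the same indices serve.\<close>

lemma Abel_universal_wrt_rotate: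
  assumes r: "admissible_radii r" and f: "f \<in> Abel_universal_wrt r" and c: "norm c = 1"
    and \<Phi>: "\<And>z. z \<in> ball 0 1 \<Longrightarrow> \<Phi> z = c * z"
  shows "f \<circ> \<Phi> \<in> Abel_universal_wrt r"
proof -
  have c0: "c \<noteq> 0" using c by auto
  have fhol: "f holomorphic_on ball 0 1" using f by (simp add: Abel_universal_wrt_def)
  have "(\<lambda>z. f (c * z)) holomorphic_on ball 0 1"
  proof -
    have "(*) c ` ball 0 1 \<subseteq> ball 0 1" using c by (auto simp: norm_mult)
    then show ?thesis
      using holomorphic_on_compose_gen[OF _ fhol, of "\<lambda>z. c * z" "ball 0 1"]
      by (simp add: o_def holomorphic_intros)
  qed
  then have hol: "f \<circ> \<Phi> holomorphic_on ball 0 1"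
    by (rule holomorphic_transform) (simp add: \<Phi>)
  have "\<exists>n :: nat \<Rightarrow> nat. strict_mono n \<and>
      uniform_limit K (\<lambda>k \<zeta>. (f \<circ> \<Phi>) (of_real (r (n k)) * \<zeta>)) \<phi> sequentially"
    if K: "compact K" "K \<subseteq> sphere 0 1" "K \<noteq> sphere 0 1" "continuous_on K \<phi>" for K \<phi>
  proof -
    let ?K = "(\<lambda>z. c * z) ` K"
    have "compact ?K" by (intro compact_continuous_image continuous_intros K)
    moreover have "?K \<subseteq> sphere 0 1" using K(2) c by (auto simp: norm_mult)
    moreover have "?K \<noteq> sphere 0 1"
    proof
      assume eq: "?K = sphere 0 1"
      have "sphere 0 1 \<subseteq> K"
      proof
        fix z :: complex assume "z \<in> sphere 0 1"
        then have "c * z \<in> ?K" unfolding eq using c by (simp add: norm_mult)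
        then show "z \<in> K" using c0 by auto
      qed
      with K show False by blast
    qed
    moreover have "continuous_on ?K (\<lambda>w. \<phi> (w / c))"
      by (rule continuous_on_compose2[OF K(4)]) (use c0 in \<open>auto intro!: continuous_intros\<close>)
    ultimately obtain n :: "nat \<Rightarrow> nat" where n: "strict_mono n"
      "uniform_limit ?K (\<lambda>k \<zeta>. f (of_real (r (n k)) * \<zeta>)) (\<lambda>w. \<phi> (w / c)) sequentially"
      using f unfolding Abel_universal_wrt_def by blast
    have "uniform_limit K (\<lambda>k \<zeta>. (f \<circ> \<Phi>) (of_real (r (n k)) * \<zeta>)) \<phi> sequentially"
    proof (rule uniform_limitI)
      fix e :: real assume "e > 0"
      with n(2) have "\<forall>\<^sub>F k in sequentially. \<forall>w\<in>?K. dist (f (of_real (r (n k)) * w)) (\<phi> (w / c)) < e"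
        by (rule uniform_limitD)
      then show "\<forall>\<^sub>F k in sequentially. \<forall>\<zeta>\<in>K. dist ((f \<circ> \<Phi>) (of_real (r (n k)) * \<zeta>)) (\<phi> \<zeta>) < e"
      proof eventually_elim
        case (elim k)
        show ?case
        proof
          fix \<zeta> assume \<zeta>: "\<zeta> \<in> K"
          have "0 \<le> r (n k)" "r (n k) < 1" using r by (auto simp: admissible_radii_def)
          moreover have "norm \<zeta> = 1" using \<zeta> K(2) by auto
          ultimately have "\<Phi> (of_real (r (n k)) * \<zeta>) = of_real (r (n k)) * (c * \<zeta>)"
            using \<Phi> by (simp add: norm_mult)
          moreover have "dist (f (of_real (r (n k)) * (c * \<zeta>))) (\<phi> (c * \<zeta> / c)) < e"
            using elim \<zeta> by blast
          ultimately show "dist ((f \<circ> \<Phi>) (of_real (r (n k)) * \<zeta>)) (\<phi> \<zeta>) < e" using c0 by simp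
        qed
      qed
    qed
    with n(1) show ?thesis by blast
  qed
  with hol show ?thesis unfolding Abel_universal_wrt_def by blast
qed

section \<open>Boundary values, reflection and boundary speed\<close>

lemma unimodular_boundary_values:
  assumes r: "admissible_radii r"
    and \<Phi>: "\<Phi> ` ball 0 1 \<subseteq> ball 0 1" "continuous_on (cball 0 1) \<Phi>"
    and univ: "\<forall>f\<in>Abel_universal_wrt r. f \<circ> \<Phi> \<in> Abel_universal"
    and \<zeta>: "\<zeta> \<in> sphere 0 1"
  shows "norm (\<Phi> \<zeta>) = 1"
proof (rule ccontr)
  assume ne: "norm (\<Phi> \<zeta>) \<noteq> 1"
  have "\<Phi> ` closure (ball 0 1) \<subseteq> cball 0 1"
    using \<Phi> by (intro image_closure_subset) auto
  moreover have "\<zeta> \<in> closure (ball 0 1)" using \<zeta> by simp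
  ultimately have "norm (\<Phi> \<zeta>) \<le> 1" using mem_cball_0 by blast
  with ne have lt: "\<Phi> \<zeta> \<in> ball 0 1" by simp
  obtain f where f: "f \<in> Abel_universal_wrt r" using Abel_universal_wrt_nonempty[OF r] .
  then have "continuous_on (ball 0 1) f"
    by (intro holomorphic_on_imp_continuous_on) (simp add: Abel_universal_wrt_def)
  then have fc: "isCont f (\<Phi> \<zeta>)" using lt by (simp add: continuous_on_eq_continuous_at)
  \<comment> \<open>Continuity of \<open>f\<close> at the interior point
    \<open>\<Phi> \<zeta>\<close> forces the limit \<open>f (\<Phi> \<zeta>)\<close>, so any other
    prescribed value gives a contradiction.\<close>
  obtain s :: "nat \<Rightarrow> real" where s: "\<And>k. s k \<in> {0..<1}" "s \<longlonglongrightarrow> 1"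
    "\<And>\<xi>. \<xi> \<in> {\<zeta>} \<Longrightarrow> (\<lambda>k. (f \<circ> \<Phi>) (of_real (s k) * \<xi>)) \<longlonglongrightarrow> f (\<Phi> \<zeta>) + 1"
    using Abel_universal_finite_set[of "f \<circ> \<Phi>" "{\<zeta>}" "\<lambda>_. f (\<Phi> \<zeta>) + 1"] univ f \<zeta> by auto
  have "(\<lambda>k. of_real (s k) * \<zeta>) \<longlonglongrightarrow> of_real 1 * \<zeta>" by (intro tendsto_intros s)
  then have "(\<lambda>k. \<Phi> (of_real (s k) * \<zeta>)) \<longlonglongrightarrow> \<Phi> \<zeta>"
    by (intro continuous_on_tendsto_compose[OF \<Phi>(2)] always_eventually allI)
       (use \<zeta> s(1) in \<open>auto simp: norm_mult less_imp_le\<close>)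
  then have "(\<lambda>k. (f \<circ> \<Phi>) (of_real (s k) * \<zeta>)) \<longlonglongrightarrow> f (\<Phi> \<zeta>)"
    using isCont_tendsto_compose[OF fc] by simp
  then show False using LIMSEQ_unique[OF _ s(3)[of \<zeta>]] by fastforce
qed

text \<open>Schwarz reflection in the coordinate \<open>z = exp (\<i> * w)\<close>: the real line
  covers the circle, where \<Phi> is unimodular, so \<Phi> continues across it by
  \<open>1 / cnj (F (cnj w))\<close>. Zeros of \<open>F\<close> near the line would spoil this;
  there are none, because the zeros of \<Phi> form a compact set off the circle.\<close>

lemma boundary_reflection:
  assumes hol: "\<Phi> holomorphic_on ball 0 1" and cont: "continuous_on (cball 0 1) \<Phi>"
    and one: "\<And>\<zeta>. \<zeta> \<in> sphere 0 1 \<Longrightarrow> norm (\<Phi> \<zeta>) = 1"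
  obtains \<epsilon> G where "\<epsilon> > 0" "G holomorphic_on {w. -\<epsilon> < Im w}"
    "\<And>w. 0 \<le> Im w \<Longrightarrow> G w = \<Phi> (exp (\<i> * w))"
proof -
  define Z where "Z = {z \<in> cball 0 1. \<Phi> z = 0}"
  have "closed Z" unfolding Z_def
    using continuous_closed_preimage_constant[OF cont closed_cball] by simp
  moreover have "Z \<subseteq> cball 0 1" by (auto simp: Z_def)
  ultimately have "compact Z" by (meson bounded_cball bounded_subset compact_eq_bounded_closed)
  then have "compact (norm ` Z)" by (intro compact_continuous_image continuous_intros)
  then have "open (- norm ` Z)" by (simp add: compact_imp_closed open_Compl)
  moreover have "1 \<in> - norm ` Z" using one by (force simp: Z_def)
  ultimately obtain e where e: "e > 0" "ball 1 e \<subseteq> - norm ` Z" by (meson open_contains_ball)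
  have nz: "\<Phi> z \<noteq> 0" if "1 - e < norm z" "norm z \<le> 1" for z
  proof
    assume "\<Phi> z = 0"
    then have "norm z \<in> norm ` Z" using that by (simp add: Z_def)
    moreover have "norm z \<in> ball 1 e" using that by (simp add: dist_real_def)
    ultimately show False using e by blast
  qed
  \<comment> \<open>The strip of height \<epsilon> above the real line corresponds to an annulus
    without zeros of \<Phi>; the minimum with \<open>1/2\<close> keeps the argument of
    \<open>ln\<close> positive.\<close>
  define \<epsilon> where "\<epsilon> = - ln (1 - min e (1/2))"
  have \<epsilon>: "\<epsilon> > 0" "exp (- \<epsilon>) \<ge> 1 - e" using e by (auto simp: \<epsilon>_def)
  define F where "F w = \<Phi> (exp (\<i> * w))" for w
  have Fnz: "F w \<noteq> 0" if "0 \<le> Im w" "Im w < \<epsilon>" for w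
  proof -
    have "exp (- \<epsilon>) < exp (- Im w)" using that by simp
    then have "1 - e < exp (- Im w)" using \<epsilon>(2) by linarith
    then show ?thesis unfolding F_def using that by (intro nz) auto
  qed
  define S where "S = {w. - \<epsilon> < Im w}"
  have S: "open S" unfolding S_def by (rule open_halfspace_Im_gt)
  have Fhol: "F holomorphic_on {w. 0 < Im w}"
  proof -
    have "(\<lambda>w. exp (\<i> * w)) holomorphic_on {w. 0 < Im w}" by (intro holomorphic_intros)
    moreover have "(\<lambda>w. exp (\<i> * w)) ` {w. 0 < Im w} \<subseteq> ball 0 1" by auto
    ultimately show ?thesis
      using holomorphic_on_compose_gen[OF _ hol] unfolding F_def by (auto simp: o_def)
  qed
  have Fcont: "continuous_on {w. 0 \<le> Im w} F"
    unfolding F_def by (rule continuous_on_compose2[OF cont]) (auto intro!: continuous_intros)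
  define G where "G w = (if 0 \<le> Im w then F w else inverse (cnj (F (cnj w))))" for w
  have lowhol: "(\<lambda>w. inverse (cnj (F (cnj w)))) holomorphic_on (S \<inter> {w. Im w < 0})"
  proof (rule holomorphic_on_inverse)
    have "cnj \<circ> F \<circ> cnj holomorphic_on (S \<inter> {w. Im w < 0})"
      by (intro holomorphic_on_compose_cnj_cnj holomorphic_on_subset[OF Fhol] open_Int S open_halfspace_Im_lt) auto
    then show "(\<lambda>w. cnj (F (cnj w))) holomorphic_on (S \<inter> {w. Im w < 0})" by (simp add: o_def)
    show "cnj (F (cnj w)) \<noteq> 0" if "w \<in> S \<inter> {w. Im w < 0}" for w
      using Fnz[of "cnj w"] that by (auto simp: S_def)
  qed
  have lowcont: "continuous_on (S \<inter> {w. Im w \<le> 0}) (\<lambda>w. inverse (cnj (F (cnj w))))"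
  proof (intro continuous_on_inverse continuous_on_cnj ballI)
    show "continuous_on (S \<inter> {w. Im w \<le> 0}) (\<lambda>w. F (cnj w))"
      by (rule continuous_on_compose2[OF Fcont]) (auto intro!: continuous_intros)
    show "cnj (F (cnj w)) \<noteq> 0" if "w \<in> S \<inter> {w. Im w \<le> 0}" for w
      using Fnz[of "cnj w"] that by (auto simp: S_def)
  qed
  have eq: "F w = inverse (cnj (F (cnj w)))" if "Im w = 0" for w
  proof -
    have "cnj w = w" using that by (simp add: complex_eq_iff)
    moreover have "norm (F w) = 1" unfolding F_def using that by (intro one) simp
    then have "F w * cnj (F w) = 1" "F w \<noteq> 0" by (auto simp flip: complex_norm_square)
    ultimately show ?thesis by (simp add: field_simps)
  qed
  have SS: "(S \<inter> {w. 0 \<le> Im w}) \<union> (S \<inter> {w. Im w \<le> 0}) = S" by auto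
  have "continuous_on ((S \<inter> {w. 0 \<le> Im w}) \<union> (S \<inter> {w. Im w \<le> 0})) G"
    unfolding G_def
  proof (rule continuous_on_cases_local)
    show "continuous_on (S \<inter> {w. 0 \<le> Im w}) F" by (rule continuous_on_subset[OF Fcont]) auto
    show "closedin (top_of_set (S \<inter> {w. 0 \<le> Im w} \<union> S \<inter> {w. Im w \<le> 0})) (S \<inter> {w. 0 \<le> Im w})"
      unfolding SS by (rule closedin_closed_Int[OF closed_halfspace_Im_ge])
    show "closedin (top_of_set (S \<inter> {w. 0 \<le> Im w} \<union> S \<inter> {w. Im w \<le> 0})) (S \<inter> {w. Im w \<le> 0})"
      unfolding SS by (rule closedin_closed_Int[OF closed_halfspace_Im_le])
    show "F w = inverse (cnj (F (cnj w)))"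
      if "w \<in> S \<inter> {w. 0 \<le> Im w} \<and> \<not> 0 \<le> Im w \<or> w \<in> S \<inter> {w. Im w \<le> 0} \<and> 0 \<le> Im w" for w
      using that by (intro eq) auto
  qed (rule lowcont)
  then have Gcont: "continuous_on S G" by (simp add: SS)
  have "G holomorphic_on S"
  \<comment> \<open>\<open>- \<i> \<bullet> z\<close> is \<open>- Im z\<close>, so the two sides are
    the upper and the lower part of \<open>S\<close>.\<close>
  proof (rule holomorphic_on_paste_across_line[OF S, of "- \<i>" _ 0])
    show "G holomorphic_on S \<inter> {z. - \<i> \<bullet> z < 0}"
      by (rule holomorphic_transform[OF holomorphic_on_subset[OF Fhol]]) (auto simp: G_def)
    show "G holomorphic_on S \<inter> {z. 0 < - \<i> \<bullet> z}"
      by (rule holomorphic_transform[OF holomorphic_on_subset[OF lowhol]]) (auto simp: G_def)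
  qed (use Gcont in auto)
  then show ?thesis using \<epsilon>(1) by (intro that[of \<epsilon> G]) (auto simp: S_def G_def F_def)
qed

text \<open>\<open>\<alpha> x\<close> is the modulus of the derivative of \<open>\<Phi>\<close> at \<open>cis x\<close>. In the coordinate \<open>z = exp (\<i> * w)\<close>, if it is a
  constant \<open>A\<close>, then the reflected function solves \<open>G' = \<i> A G\<close> on the real line, hence everywhere.\<close>

lemma boundary_speed:
  assumes hol: "\<Phi> holomorphic_on ball 0 1" and sub: "\<Phi> ` ball 0 1 \<subseteq> ball 0 1"
    and cont: "continuous_on (cball 0 1) \<Phi>"
    and one: "\<And>\<zeta>. \<zeta> \<in> sphere 0 1 \<Longrightarrow> norm (\<Phi> \<zeta>) = 1"
  obtains \<alpha> :: "real \<Rightarrow> real" where "continuous_on UNIV \<alpha>" "\<And>x. 0 \<le> \<alpha> x"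
    "\<And>x. ((\<lambda>t. (1 - norm (\<Phi> (of_real (exp (- t)) * cis x))) / t) \<longlongrightarrow> \<alpha> x) (at_right 0)"
    "\<And>A. (\<And>x. \<alpha> x = A) \<Longrightarrow> \<exists>C. \<forall>w. 0 \<le> Im w \<longrightarrow> \<Phi> (exp (\<i> * w)) = C * exp (\<i> * of_real A * w)"
proof -
  obtain \<epsilon> G where \<epsilon>: "\<epsilon> > 0" and G: "G holomorphic_on {w. -\<epsilon> < Im w}"
    and GF: "\<And>w. 0 \<le> Im w \<Longrightarrow> G w = \<Phi> (exp (\<i> * w))"
    using boundary_reflection[OF hol cont one] by blast
  define S where "S = {w. -\<epsilon> < Im w}"
  have S: "open S" "convex S" unfolding S_def by (rule open_halfspace_Im_gt convex_halfspace_Im_gt)+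
  have GS: "G holomorphic_on S" using G by (simp add: S_def)
  have rS: "of_real x \<in> S" for x using \<epsilon> by (simp add: S_def)
  have D: "(G has_field_derivative deriv G w) (at w)" if "w \<in> S" for w
    using GS S(1) that by (rule holomorphic_derivI)
  have G1: "norm (G (of_real x)) = 1" for x by (subst GF) (auto intro: one)
  then have G0: "G (of_real x) \<noteq> 0" for x by (metis norm_zero zero_neq_one)
  \<comment> \<open>The logarithmic derivative of \<open>G\<close>; on the real line it is purely
    imaginary, because \<open>G\<close> has constant modulus there.\<close>
  define \<beta> where "\<beta> x = deriv G (of_real x) / G (of_real x)" for x :: real
  define \<alpha> where "\<alpha> x = Im (\<beta> x)" for x
  have "deriv G holomorphic_on S" using GS S(1) by (rule holomorphic_deriv)
  then have dc: "continuous_on S (deriv G)" by (rule holomorphic_on_imp_continuous_on)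
  have Gc: "continuous_on S G" using GS by (rule holomorphic_on_imp_continuous_on)
  have "continuous_on UNIV \<beta>" unfolding \<beta>_def
    by (intro continuous_on_divide continuous_on_compose2[OF dc] continuous_on_compose2[OF Gc] continuous_intros)
       (use rS G0 in auto)
  then have \<alpha>c: "continuous_on UNIV \<alpha>" unfolding \<alpha>_def by (intro continuous_intros)
  have Re0: "Re (\<beta> x) = 0" for x
  proof -
    have "((\<lambda>x. G (of_real x)) has_vector_derivative deriv G (of_real x)) (at x)"
      using has_vector_derivative_real_field[OF D[OF rS]] .
    then have "((\<lambda>x. G (of_real x)) has_derivative (\<lambda>h. h *\<^sub>R deriv G (of_real x))) (at x)"
      by (simp add: has_vector_derivative_def)
    from has_derivative_inner[OF this this]
    have "((\<lambda>x. G (of_real x) \<bullet> G (of_real x)) has_real_derivative 2 * (G (of_real x) \<bullet> deriv G (of_real x))) (at x)"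
      unfolding has_field_derivative_def
      by (rule has_derivative_eq_rhs) (simp add: fun_eq_iff inner_commute algebra_simps)
    moreover have "(\<lambda>x. G (of_real x) \<bullet> G (of_real x)) = (\<lambda>x. 1)"
      using G1 by (simp add: norm_eq_1 fun_eq_iff)
    ultimately have "((\<lambda>x. 1) has_real_derivative 2 * (G (of_real x) \<bullet> deriv G (of_real x))) (at x)"
      by simp
    then have "2 * (G (of_real x) \<bullet> deriv G (of_real x)) = 0"
      using DERIV_unique DERIV_const by blast
    then show ?thesis by (simp add: \<beta>_def Re_divide inner_complex_def mult.commute)
  qed
  have \<beta>: "\<beta> x = \<i> * of_real (\<alpha> x)" for x by (simp add: complex_eq_iff Re0 \<alpha>_def)
  have lim: "((\<lambda>t. (1 - norm (\<Phi> (of_real (exp (- t)) * cis x))) / t) \<longlongrightarrow> \<alpha> x) (at_right 0)" for x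
  proof -
    \<comment> \<open>\<open>q t = 1 + t * u t\<close> is the quotient of \<open>G\<close> at
      \<open>x + \<i> * t\<close> by \<open>G x\<close>, and \<open>u\<close> tends to
      \<open>\<i> * \<beta> x = - \<alpha> x\<close>. Expanding the square of
      \<open>norm (q t)\<close> expresses \<open>(1 - norm (q t)) / t\<close> through
      \<open>u t\<close>.\<close>
    define u where "u t = (G (of_real x + \<i> * of_real t) - G (of_real x)) / (\<i> * of_real t) * (\<i> / G (of_real x))" for t
    define q where "q t = 1 + of_real t * u t" for t
    have "((\<lambda>h. (G (of_real x + h) - G (of_real x)) / h) \<longlongrightarrow> deriv G (of_real x)) (at 0)"
      using D[OF rS] by (simp add: DERIV_def)
    moreover have "filterlim (\<lambda>t. \<i> * complex_of_real t) (at 0) (at_right 0)"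
    proof -
      have "((\<lambda>t. \<i> * complex_of_real t) \<longlongrightarrow> \<i> * of_real 0) (at_right 0)" by (intro tendsto_intros)
      moreover have "\<forall>\<^sub>F t in at_right 0. \<i> * complex_of_real t \<noteq> 0"
        unfolding eventually_at_right_field by (intro exI[of _ 1]) auto
      ultimately show ?thesis by (simp add: filterlim_at)
    qed
    ultimately have "((\<lambda>t. (G (of_real x + \<i> * of_real t) - G (of_real x)) / (\<i> * of_real t)) \<longlongrightarrow>
        deriv G (of_real x)) (at_right 0)"
      by (rule filterlim_compose)
    then have "(u \<longlongrightarrow> deriv G (of_real x) * (\<i> / G (of_real x))) (at_right 0)"
      unfolding u_def by (rule tendsto_mult[OF _ tendsto_const])
    moreover have "deriv G (of_real x) * (\<i> / G (of_real x)) = \<i> * \<beta> x" by (simp add: \<beta>_def)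
    ultimately have u: "(u \<longlongrightarrow> - of_real (\<alpha> x)) (at_right 0)" by (simp add: \<beta>)
    have tt: "((\<lambda>t::real. t) \<longlongrightarrow> 0) (at_right 0)" by (rule tendsto_ident_at)
    have "(q \<longlongrightarrow> 1 + of_real 0 * - of_real (\<alpha> x)) (at_right 0)"
      unfolding q_def by (intro tendsto_intros u tt)
    then have q: "(q \<longlongrightarrow> 1) (at_right 0)" by simp
    have "((\<lambda>t. (- 2 * Re (u t) - t * (norm (u t))\<^sup>2) / (1 + norm (q t))) \<longlongrightarrow>
        (- 2 * Re (- of_real (\<alpha> x)) - 0 * (norm (- of_real (\<alpha> x) :: complex))\<^sup>2) / (1 + norm (1::complex))) (at_right 0)"
      by (intro tendsto_intros u q tt) auto
    then have "((\<lambda>t. (- 2 * Re (u t) - t * (norm (u t))\<^sup>2) / (1 + norm (q t))) \<longlongrightarrow> \<alpha> x) (at_right 0)"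
      by (rule tendsto_eq_rhs) simp
    then show ?thesis
    proof (rule Lim_transform_eventually)
      show "\<forall>\<^sub>F t in at_right 0. (- 2 * Re (u t) - t * (norm (u t))\<^sup>2) / (1 + norm (q t)) =
          (1 - norm (\<Phi> (of_real (exp (- t)) * cis x))) / t"
        unfolding eventually_at_right_field
      proof (intro exI[of _ 1] conjI allI impI)
        fix t :: real assume t: "0 < t" "t < 1"
        have "\<i> * (of_real x + \<i> * of_real t) = of_real (- t) + \<i> * of_real x"
          by (simp add: algebra_simps)
        then have "exp (\<i> * (of_real x + \<i> * of_real t)) = of_real (exp (- t)) * cis x"
          by (simp only: exp_add cis_conv_exp exp_of_real)
        then have "G (of_real x + \<i> * of_real t) = \<Phi> (of_real (exp (- t)) * cis x)"
          using GF[of "of_real x + \<i> * of_real t"] t by simp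
        moreover have "q t = G (of_real x + \<i> * of_real t) / G (of_real x)"
          using t G0[of x] by (simp add: q_def u_def field_simps)
        ultimately have "norm (q t) = norm (\<Phi> (of_real (exp (- t)) * cis x))"
          using G1 by (simp add: norm_divide)
        moreover have "(- 2 * Re (u t) - t * (norm (u t))\<^sup>2) / (1 + norm (q t)) = (1 - norm (q t)) / t"
        proof -
          define v where "v = u t"
          have qv: "q t = 1 + t *\<^sub>R v" by (simp add: v_def q_def scaleR_conv_of_real)
          have "(norm (q t))\<^sup>2 = 1 + 2 * t * Re v + t\<^sup>2 * (norm v)\<^sup>2"
            unfolding qv cmod_power2 by (simp add: power2_eq_square algebra_simps)
          then have "(1 - norm (q t)) * (1 + norm (q t)) = t * (- 2 * Re v - t * (norm v)\<^sup>2)"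
            by (simp add: power2_eq_square algebra_simps)
          moreover have "1 + norm (q t) > 0" by (simp add: add_pos_nonneg)
          ultimately show ?thesis using t unfolding v_def[symmetric] by (simp add: field_simps)
        qed
        ultimately show "(- 2 * Re (u t) - t * (norm (u t))\<^sup>2) / (1 + norm (q t)) =
          (1 - norm (\<Phi> (of_real (exp (- t)) * cis x))) / t" by simp
      qed simp
    qed
  qed
  have nonneg: "0 \<le> \<alpha> x" for x
  proof (rule tendsto_lowerbound[OF lim])
    show "\<forall>\<^sub>F t in at_right 0. 0 \<le> (1 - norm (\<Phi> (of_real (exp (- t)) * cis x))) / t"
      unfolding eventually_at_right_field
    proof (intro exI[of _ 1] conjI allI impI)
      fix t :: real assume t: "0 < t" "t < 1"
      then have "of_real (exp (- t)) * cis x \<in> ball 0 1" by (simp add: norm_mult)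
      then have "\<Phi> (of_real (exp (- t)) * cis x) \<in> ball 0 1" using sub by blast
      then show "0 \<le> (1 - norm (\<Phi> (of_real (exp (- t)) * cis x))) / t" using t by simp
    qed simp
  qed simp
  have const: "\<exists>C. \<forall>w. 0 \<le> Im w \<longrightarrow> \<Phi> (exp (\<i> * w)) = C * exp (\<i> * of_real A * w)"
    if A: "\<And>x. \<alpha> x = A" for A
  proof -
    have ode: "deriv G w - \<i> * of_real A * G w = 0" if "w \<in> S" for w
    proof (rule analytic_continuation[where f = "\<lambda>w. deriv G w - \<i> * of_real A * G w" and U = \<real> and \<xi> = 0])
      show "(\<lambda>w. deriv G w - \<i> * of_real A * G w) holomorphic_on S"
        by (intro holomorphic_intros GS S(1))
      show "connected S" using S(2) by (rule convex_connected)
      show "\<real> \<subseteq> S" using rS by (auto elim: Reals_cases)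
      show "0 \<in> S" using rS[of 0] by simp
      show "(0::complex) islimpt \<real>"
        unfolding islimpt_approachable
      proof (intro allI impI)
        fix e :: real assume "e > 0"
        then show "\<exists>x'\<in>\<real>. x' \<noteq> (0::complex) \<and> dist x' 0 < e"
          by (intro bexI[of _ "of_real (e/2)"]) auto
      qed
      fix z :: complex assume "z \<in> \<real>"
      then obtain x where z: "z = of_real x" by (elim Reals_cases)
      show "deriv G z - \<i> * of_real A * G z = 0"
        using \<beta>[of x] G0[of x] A[of x] by (simp add: z \<beta>_def field_simps)
    qed (use S that in auto)
    \<comment> \<open>The exponential is the integrating factor of the differential
      equation.\<close>
    have "((\<lambda>w. G w * exp (- (\<i> * of_real A * w))) has_field_derivative 0) (at w within S)" if w: "w \<in> S" for w
    proof -
      have "deriv G w = \<i> * of_real A * G w" using ode[OF w] by simp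
      then have "(G has_field_derivative \<i> * of_real A * G w) (at w within S)"
        using D[OF w] has_field_derivative_at_within by metis
      then show ?thesis by (auto intro!: derivative_eq_intros simp: algebra_simps)
    qed
    from has_field_derivative_zero_constant[OF S(2) this]
    obtain C where C: "\<And>w. w \<in> S \<Longrightarrow> G w * exp (- (\<i> * of_real A * w)) = C" by blast
    have "\<Phi> (exp (\<i> * w)) = C * exp (\<i> * of_real A * w)" if "0 \<le> Im w" for w
    proof -
      have "w \<in> S" using that \<epsilon> by (simp add: S_def)
      from C[OF this] have "G w = C * exp (\<i> * of_real A * w)"
        by (simp add: exp_minus field_simps)
      then show ?thesis using GF[OF that] by simp
    qed
    then show ?thesis by blast
  qed
  show ?thesis by (rule that[OF \<alpha>c nonneg lim const])
qed

section \<open>Constant boundary speed and power maps\<close>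

text \<open>Adding \<open>2 * pi\<close> to \<open>w\<close> does not change
  \<open>exp (\<i> * w)\<close>, which forces \<open>A\<close> to be an integer \<open>d\<close>;
  \<open>d = 0\<close> would make \<Phi> unimodular inside the disc.\<close>

lemma power_map_if_constant_speed:
  assumes sub: "\<Phi> ` ball 0 1 \<subseteq> ball 0 1" and cont: "continuous_on (cball 0 1) \<Phi>"
    and one: "\<And>\<zeta>. \<zeta> \<in> sphere 0 1 \<Longrightarrow> norm (\<Phi> \<zeta>) = 1"
    and A: "0 \<le> A" and eq: "\<And>w. 0 \<le> Im w \<Longrightarrow> \<Phi> (exp (\<i> * w)) = C * exp (\<i> * of_real A * w)"
  obtains d where "d > 0" "norm C = 1" "\<And>z. z \<in> cball 0 1 \<Longrightarrow> \<Phi> z = C * z ^ d"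
proof -
  have C: "\<Phi> 1 = C" using eq[of 0] by simp
  then have nC: "norm C = 1" using one[of 1] by simp
  have "exp (\<i> * of_real (2 * pi)) = (1::complex)" using exp_two_pi_i' by (simp add: mult_ac)
  then have "C = C * exp (\<i> * of_real A * of_real (2 * pi))"
    using eq[of "of_real (2 * pi)"] C by simp
  then have "exp (\<i> * of_real A * of_real (2 * pi)) = 1" using nC by auto
  then obtain n :: int where "A * (2 * pi) = of_int (2 * n) * pi" unfolding exp_eq_1 by auto
  then have "A = of_int n" by simp
  moreover define d where "d = nat n"
  ultimately have d: "A = of_nat d" using A by simp
  have nz: "\<Phi> z = C * z ^ d" if "z \<noteq> 0" "z \<in> cball 0 1" for z
  proof -
    \<comment> \<open>\<open>- \<i> * Ln z\<close> is a preimage of \<open>z\<close> under the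
      coordinate; its imaginary part is \<open>- ln (norm z)\<close>.\<close>
    have "0 \<le> Im (- \<i> * Ln z)" using that by simp
    moreover have iL: "\<i> * (- \<i> * Ln z) = Ln z" by simp
    moreover have "\<i> * of_real A * (- \<i> * Ln z) = of_nat d * Ln z"
    proof -
      have "\<i> * of_real A * (- \<i> * Ln z) = of_real A * (\<i> * (- \<i> * Ln z))"
        by (simp only: mult_ac)
      then show ?thesis unfolding iL d by simp
    qed
    ultimately have "\<Phi> (exp (Ln z)) = C * exp (of_nat d * Ln z)" using eq by metis
    then show ?thesis using that(1) by (simp add: exp_of_nat_mult)
  qed
  have d0: "d > 0"
  proof (rule ccontr)
    assume "\<not> d > 0"
    then have "norm (\<Phi> (1/2)) = 1" using nz[of "1/2"] nC by simp
    moreover have "\<Phi> (1/2) \<in> ball 0 1" by (rule subsetD[OF sub imageI]) simp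
    ultimately show False by simp
  qed
  \<comment> \<open>No \<open>w\<close> is mapped to \<open>0\<close> by the coordinate, so the
    value there comes from continuity.\<close>
  have "\<Phi> 0 = 0"
  proof -
    define a where "a k = inverse (real (Suc k))" for k
    have a: "0 < a k" "a k \<le> 1" for k by (auto simp: a_def field_simps)
    have "a \<longlonglongrightarrow> 0" unfolding a_def by (rule LIMSEQ_inverse_real_of_nat)
    then have l: "(\<lambda>k. complex_of_real (a k)) \<longlonglongrightarrow> 0" using tendsto_of_real by force
    then have 1: "(\<lambda>k. \<Phi> (of_real (a k))) \<longlonglongrightarrow> \<Phi> 0"
      by (intro continuous_on_tendsto_compose[OF cont] always_eventually allI) (use a in \<open>auto simp: abs_le_iff less_imp_le\<close>)
    have "(\<lambda>k. C * of_real (a k) ^ d) \<longlonglongrightarrow> C * 0 ^ d"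
      by (intro tendsto_intros l)
    moreover have "\<Phi> (of_real (a k)) = C * of_real (a k) ^ d" for k
      using a[of k] by (intro nz) auto
    ultimately have "(\<lambda>k. \<Phi> (of_real (a k))) \<longlonglongrightarrow> 0" using d0 by (simp add: zero_power)
    with 1 show ?thesis by (rule LIMSEQ_unique)
  qed
  then have "\<Phi> z = C * z ^ d" if "z \<in> cball 0 1" for z
    using nz[of z] that d0 by (cases "z = 0") auto
  then show ?thesis using that d0 nC by blast
qed

text \<open>\<open>1\<close> and a primitive \<open>d\<close>-th root of unity have the same
  \<open>d\<close>-th power, so \<open>f \<circ> \<Phi>\<close> takes equal values along the two
  radii, while universality would allow different limits.\<close>

lemma not_Abel_universal_if_power_ge_2:
  assumes h: "f \<circ> \<Phi> \<in> Abel_universal" and d: "d \<ge> 2" and eq: "\<And>z. z \<in> cball 0 1 \<Longrightarrow> \<Phi> z = C * z ^ d"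
  shows False
proof -
  define \<omega> where "\<omega> = cis (2 * pi / real d)"
  have "real d * (2 * pi / real d) = 2 * pi" using d by simp
  then have \<omega>d: "\<omega> ^ d = 1" by (simp only: \<omega>_def Complex.DeMoivre cis_2pi)
  have "\<omega> \<noteq> 1"
  proof
    assume "\<omega> = 1"
    then have "exp (\<i> * of_real (2 * pi / real d)) = 1" by (simp add: \<omega>_def cis_conv_exp)
    then obtain n :: int where "2 * pi / real d = of_int (2 * n) * pi" unfolding exp_eq_1 by auto
    then have "1 = of_int n * real d" using d by (simp add: field_simps)
    then have "1 = n * int d" by (metis of_int_1 of_int_eq_iff of_int_mult of_int_of_nat_eq)
    then have "int d dvd 1" by (metis dvd_triv_right)
    then show False using d by simp
  qed
  define \<phi> where "\<phi> z = (if z = \<omega> then 1 else 0 :: complex)" for z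
  obtain s :: "nat \<Rightarrow> real" where s: "\<And>k. s k \<in> {0..<1}"
    "\<And>\<xi>. \<xi> \<in> {1, \<omega>} \<Longrightarrow> (\<lambda>k. (f \<circ> \<Phi>) (of_real (s k) * \<xi>)) \<longlonglongrightarrow> \<phi> \<xi>"
    by (rule Abel_universal_finite_set[OF h, of "{1, \<omega>}" \<phi>]) (auto simp: \<omega>_def)
  have "(f \<circ> \<Phi>) (of_real (s k) * 1) = (f \<circ> \<Phi>) (of_real (s k) * \<omega>)" for k
  proof -
    have "of_real (s k) * \<xi> \<in> cball 0 1" if "norm \<xi> = 1" for \<xi> :: complex
      using s(1)[of k] that by (simp add: norm_mult)
    from eq[OF this[of 1]] eq[OF this[of \<omega>]] show ?thesis
      using \<omega>d by (simp add: power_mult_distrib) (simp add: \<omega>_def)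
  qed
  then have "(\<lambda>k. (f \<circ> \<Phi>) (of_real (s k) * 1)) \<longlonglongrightarrow> \<phi> \<omega>" using s(2)[of \<omega>] by simp
  moreover have "(\<lambda>k. (f \<circ> \<Phi>) (of_real (s k) * 1)) \<longlonglongrightarrow> \<phi> 1" using s(2)[of 1] by blast
  ultimately have "\<phi> \<omega> = \<phi> 1" by (rule LIMSEQ_unique)
  then show False using \<open>\<omega> \<noteq> 1\<close> by (simp add: \<phi>_def)
qed

text \<open>Take \<open>f\<close> bounded by \<open>1\<close> on the images of two radii, off annuli that are thin and sparse compared with
  \<open>\<alpha>2 / \<alpha>1\<close>. Close to the boundary, \<open>\<Phi> (s * cis x1)\<close> and \<open>\<Phi> (s * cis x2)\<close> are never both inside the
  annuli, so \<open>f \<circ> \<Phi>\<close> cannot approach \<open>2\<close> at both \<open>cis x1\<close> and \<open>cis x2\<close>.\<close>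

lemma not_Abel_universal_if_distinct_speeds:
  fixes \<alpha>1 \<alpha>2 :: real
  assumes r: "admissible_radii r"
    and sub: "\<Phi> ` ball 0 1 \<subseteq> ball 0 1" and cont: "continuous_on (cball 0 1) \<Phi>"
    and univ: "\<forall>f\<in>Abel_universal_wrt r. f \<circ> \<Phi> \<in> Abel_universal"
    and \<alpha>: "0 < \<alpha>1" "\<alpha>1 < \<alpha>2"
    and lim1: "((\<lambda>t. (1 - norm (\<Phi> (of_real (exp (- t)) * cis x1))) / t) \<longlongrightarrow> \<alpha>1) (at_right 0)"
    and lim2: "((\<lambda>t. (1 - norm (\<Phi> (of_real (exp (- t)) * cis x2))) / t) \<longlongrightarrow> \<alpha>2) (at_right 0)"
  shows False
proof -
  have r1: "r n < 1" for n using r by (simp add: admissible_radii_def)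
  have rlim: "r \<longlonglongrightarrow> 1" using r by (simp add: admissible_radii_def)
  have rmono: "r i \<le> r j" if "i \<le> j" for i j using r that by (auto simp: admissible_radii_def incseq_def)
  \<comment> \<open>The distances of the two image points from the circle have a ratio tending to
    \<open>\<kappa> > 1\<close>. Within one annulus such ratios stay below
    \<open>(1 + \<epsilon>) / (1 - \<epsilon>) = \<mu>\<close>, and
    \<open>\<mu> < \<kappa>\<close>.\<close>
  define \<kappa> where "\<kappa> = \<alpha>2 / \<alpha>1"
  define \<mu> where "\<mu> = (1 + \<kappa>) / 2"
  define \<epsilon> where "\<epsilon> = (\<mu> - 1) / (\<mu> + 1)"
  have \<kappa>: "1 < \<kappa>" using \<alpha> by (simp add: \<kappa>_def)
  then have \<mu>: "1 < \<mu>" "\<mu> < \<kappa>" by (auto simp: \<mu>_def)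
  have \<epsilon>: "0 < \<epsilon>" "1 + \<epsilon> = \<mu> * (1 - \<epsilon>)" "\<epsilon> < 1" using \<mu>(1) by (auto simp: \<epsilon>_def field_simps)
  \<comment> \<open>The gap factor:
    \<open>(1 - \<epsilon>) * M = 2 * \<kappa> * (1 + \<epsilon>)\<close>, so a distance in an
    earlier annulus exceeds \<open>2 * \<kappa>\<close> times any distance in a later one.\<close>
  define M where "M = 2 * \<kappa> * \<mu>"
  have M: "M > 0" using \<kappa> \<mu> by (simp add: M_def)
  define \<delta> where "\<delta> n = \<epsilon> * (1 - r n)" for n
  have \<delta>pos: "\<delta> n > 0" for n using \<epsilon> r1[of n] by (simp add: \<delta>_def)
  have "\<delta> \<longlonglongrightarrow> \<epsilon> * (1 - 1)" unfolding \<delta>_def by (intro tendsto_intros rlim)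
  then have \<delta>lim: "\<delta> \<longlonglongrightarrow> 0" by simp
  have "\<exists>N. \<forall>n\<ge>N. M * (1 - r n) \<le> 1 - r k" for k
  proof -
    have "(\<lambda>n. M * (1 - r n)) \<longlonglongrightarrow> M * (1 - 1)" by (intro tendsto_intros rlim)
    then have "\<forall>\<^sub>F n in sequentially. M * (1 - r n) < 1 - r k"
      using r1[of k] by (intro order_tendstoD) auto
    then show ?thesis unfolding eventually_sequentially by (meson less_imp_le)
  qed
  then obtain g where g: "\<And>k n. g k \<le> n \<Longrightarrow> M * (1 - r n) \<le> 1 - r k" by metis
  define R where "R x = (\<lambda>s. complex_of_real s * cis x) ` {0..1}" for x
  define \<Gamma> where "\<Gamma> = \<Phi> ` (R x1 \<union> R x2)"
  have R: "compact (R x)" "R x \<subseteq> cball 0 1" "R x \<subseteq> insert (cis x) (ball 0 1)" for x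
  proof -
    show "compact (R x)" unfolding R_def by (intro compact_continuous_image continuous_intros) simp
    show "R x \<subseteq> cball 0 1" by (auto simp: R_def norm_mult)
    show "R x \<subseteq> insert (cis x) (ball 0 1)"
    proof
      fix z assume "z \<in> R x"
      then obtain s where "s \<in> {0..1}" "z = of_real s * cis x" by (auto simp: R_def)
      then show "z \<in> insert (cis x) (ball 0 1)" by (cases "s = 1") (auto simp: norm_mult)
    qed
  qed
  have "\<Phi> ` closure (ball 0 1) \<subseteq> cball 0 1"
    using sub cont by (intro image_closure_subset) auto
  then have "\<Phi> ` cball 0 1 \<subseteq> cball 0 1" by simp
  then have \<Gamma>sub: "\<Gamma> \<subseteq> cball 0 1" using R(2) unfolding \<Gamma>_def by blast
  have \<Gamma>comp: "compact \<Gamma>" unfolding \<Gamma>_def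
    by (intro compact_continuous_image continuous_on_subset[OF cont] compact_Un R Un_least)
  \<comment> \<open>Only the end points of the two radii can be mapped to the circle.\<close>
  have "\<Gamma> \<inter> sphere 0 1 \<subseteq> {\<Phi> (cis x1), \<Phi> (cis x2)}"
  proof
    fix w assume w: "w \<in> \<Gamma> \<inter> sphere 0 1"
    then obtain z where z: "z \<in> R x1 \<union> R x2" "w = \<Phi> z" by (auto simp: \<Gamma>_def)
    have "z \<notin> ball 0 1"
    proof
      assume "z \<in> ball 0 1"
      then have "w \<in> ball 0 1" using sub z by blast
      then show False using w by simp
    qed
    then show "w \<in> {\<Phi> (cis x1), \<Phi> (cis x2)}" using z R(3) by blast
  qed
  then have fin: "finite (\<Gamma> \<inter> sphere 0 1)" by (rule finite_subset) simp
  have dense: "sphere 0 1 \<subseteq> closure (sphere 0 1 - \<Gamma>)"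
  proof
    fix z :: complex assume "z \<in> sphere 0 1"
    then have "z islimpt sphere 0 1" by (rule islimpt_circle)
    moreover have "sphere 0 1 = (\<Gamma> \<inter> sphere 0 1) \<union> (sphere 0 1 - \<Gamma>)" by blast
    ultimately have "z islimpt (sphere 0 1 - \<Gamma>)" using islimpt_Un_finite[OF fin] by metis
    then show "z \<in> closure (sphere 0 1 - \<Gamma>)" by (simp add: closure_def)
  qed
  obtain f m where f: "f \<in> Abel_universal_wrt r" and m: "strict_mono m" "\<And>j. g (m j) \<le> m (Suc j)"
    and small: "\<And>z. z \<in> \<Gamma> \<Longrightarrow> norm z < 1 \<Longrightarrow> (\<And>j. \<delta> (m j) \<le> \<bar>norm z - r (m j)\<bar>) \<Longrightarrow> norm (f z) \<le> 1"
    using Abel_universal_small_off_annuli[OF r \<Gamma>comp \<Gamma>sub dense \<delta>pos \<delta>lim] by metis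
  \<comment> \<open>The target \<open>2\<close> exceeds the bound \<open>1\<close> valid on \<Gamma>
    off the annuli, so for late \<open>k\<close> both image points lie in annuli.\<close>
  obtain s :: "nat \<Rightarrow> real" where s: "\<And>k. s k \<in> {0..<1}" "s \<longlonglongrightarrow> 1"
    "\<And>\<xi>. \<xi> \<in> {cis x1, cis x2} \<Longrightarrow> (\<lambda>k. (f \<circ> \<Phi>) (of_real (s k) * \<xi>)) \<longlonglongrightarrow> 2"
    by (rule Abel_universal_finite_set[of "f \<circ> \<Phi>" "{cis x1, cis x2}" "\<lambda>_. 2"]) (use univ f in auto)
  define p where "p x k = norm (\<Phi> (of_real (s k) * cis x))" for x k
  have near: "\<forall>\<^sub>F k in sequentially. \<exists>j. \<bar>p x k - r (m j)\<bar> < \<epsilon> * (1 - r (m j))" if x: "x \<in> {x1, x2}" for x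
  proof -
    have "(\<lambda>k. norm ((f \<circ> \<Phi>) (of_real (s k) * cis x))) \<longlonglongrightarrow> norm (2 :: complex)"
      using s(3)[of "cis x"] x by (intro tendsto_norm) auto
    then have "\<forall>\<^sub>F k in sequentially. 1 < norm ((f \<circ> \<Phi>) (of_real (s k) * cis x))"
      by (intro order_tendstoD) auto
    then show ?thesis
    proof eventually_elim
      case (elim k)
      let ?z = "of_real (s k) * cis x"
      have "?z \<in> R x1 \<union> R x2" using x s(1)[of k] by (auto simp: R_def)
      then have "\<Phi> ?z \<in> \<Gamma>" by (auto simp: \<Gamma>_def)
      moreover have "?z \<in> ball 0 1" using s(1)[of k] by (simp add: norm_mult)
      then have "\<Phi> ?z \<in> ball 0 1" using sub by blast
      then have "norm (\<Phi> ?z) < 1" by simp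
      moreover have "\<not> norm (f (\<Phi> ?z)) \<le> 1" using elim by simp
      ultimately have "\<not> (\<forall>j. \<delta> (m j) \<le> \<bar>norm (\<Phi> ?z) - r (m j)\<bar>)" using small by blast
      then show ?case by (auto simp: p_def \<delta>_def not_le)
    qed
  qed
  have spos: "\<forall>\<^sub>F k in sequentially. 0 < s k" using s(2) by (rule order_tendstoD) simp
  \<comment> \<open>\<open>t = - ln s\<close> turns \<open>exp (- t)\<close> into the radius
    \<open>s\<close>; the common factor \<open>t\<close> cancels in the ratio below.\<close>
  have t: "filterlim (\<lambda>k. - ln (s k)) (at_right 0) sequentially"
  proof (rule tendsto_imp_filterlim_at_right)
    have "(\<lambda>k. - ln (s k)) \<longlonglongrightarrow> - ln 1" by (intro tendsto_intros s(2)) simp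
    then show "(\<lambda>k. - ln (s k)) \<longlonglongrightarrow> 0" by simp
    show "\<forall>\<^sub>F k in sequentially. 0 < - ln (s k)"
      using spos by eventually_elim (use s(1) in auto)
  qed
  have plim: "(\<lambda>k. (1 - p x k) / (- ln (s k))) \<longlonglongrightarrow> a"
    if "((\<lambda>t. (1 - norm (\<Phi> (of_real (exp (- t)) * cis x))) / t) \<longlongrightarrow> a) (at_right 0)" for x a
    using filterlim_compose[OF that t]
  proof (rule Lim_transform_eventually)
    show "\<forall>\<^sub>F k in sequentially. (1 - norm (\<Phi> (of_real (exp (- (- ln (s k)))) * cis x))) / (- ln (s k)) =
        (1 - p x k) / (- ln (s k))"
      using spos by eventually_elim (simp add: p_def)
  qed
  have "(\<lambda>k. ((1 - p x2 k) / (- ln (s k))) / ((1 - p x1 k) / (- ln (s k)))) \<longlonglongrightarrow> \<kappa>"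
    unfolding \<kappa>_def using \<alpha> by (intro tendsto_divide plim lim1 lim2) auto
  then have ratio: "(\<lambda>k. (1 - p x2 k) / (1 - p x1 k)) \<longlonglongrightarrow> \<kappa>"
  proof (rule Lim_transform_eventually)
    show "\<forall>\<^sub>F k in sequentially. ((1 - p x2 k) / (- ln (s k))) / ((1 - p x1 k) / (- ln (s k))) =
        (1 - p x2 k) / (1 - p x1 k)"
      using spos
    proof eventually_elim
      case (elim k)
      have cancel: "(x / c) / (y / c) = x / y" if "c \<noteq> 0" for x y c :: real using that by simp
      have "- ln (s k) \<noteq> 0" using elim s(1)[of k] by simp
      then show ?case by (rule cancel)
    qed
  qed
  have "\<forall>\<^sub>F k in sequentially. \<mu> < (1 - p x2 k) / (1 - p x1 k)"
    "\<forall>\<^sub>F k in sequentially. (1 - p x2 k) / (1 - p x1 k) < 2 * \<kappa>"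
    using \<mu>(2) \<kappa> by (intro order_tendstoD[OF ratio]; simp)+
  moreover note near[of x1] near[of x2]
  ultimately have "\<forall>\<^sub>F k in sequentially. \<mu> < (1 - p x2 k) / (1 - p x1 k) \<and> (1 - p x2 k) / (1 - p x1 k) < 2 * \<kappa> \<and>
      (\<exists>j. \<bar>p x1 k - r (m j)\<bar> < \<epsilon> * (1 - r (m j))) \<and> (\<exists>j. \<bar>p x2 k - r (m j)\<bar> < \<epsilon> * (1 - r (m j)))"
    unfolding eventually_conj_iff by auto
  then obtain k i j where k: "\<mu> < (1 - p x2 k) / (1 - p x1 k)" "(1 - p x2 k) / (1 - p x1 k) < 2 * \<kappa>"
    and i: "\<bar>p x1 k - r (m i)\<bar> < \<epsilon> * (1 - r (m i))" and j: "\<bar>p x2 k - r (m j)\<bar> < \<epsilon> * (1 - r (m j))"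
    using eventually_happens'[OF sequentially_bot] by blast
  define a b where "a = 1 - r (m i)" and "b = 1 - r (m j)"
  define u v where "u = 1 - p x1 k" and "v = 1 - p x2 k"
  have ab: "a > 0" "b > 0" using r1 by (auto simp: a_def b_def)
  have u: "(1 - \<epsilon>) * a < u" "u < (1 + \<epsilon>) * a" using i by (auto simp: u_def a_def algebra_simps abs_less_iff)
  have v: "(1 - \<epsilon>) * b < v" "v < (1 + \<epsilon>) * b" using j by (auto simp: v_def b_def algebra_simps abs_less_iff)
  have "0 < (1 - \<epsilon>) * a" using \<epsilon> ab by simp
  then have u0: "u > 0" using u by linarith
  have k': "\<mu> * u < v" "v < 2 * \<kappa> * u" using k u0 by (auto simp: u_def v_def field_simps)
  show False
  \<comment> \<open>If the annulus of \<open>v\<close> is that of \<open>u\<close> or one closer to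
    the circle, then \<open>v < \<mu> * u\<close>; otherwise the gap makes \<open>v\<close> exceed
    \<open>2 * \<kappa> * u\<close>.\<close>
  proof (cases "i \<le> j")
    case True
    then have "b \<le> a" using rmono[of "m i" "m j"] strict_mono_less_eq[OF m(1)] by (simp add: a_def b_def)
    have "v < \<mu> * (1 - \<epsilon>) * b" using v \<epsilon> by simp
    also have "\<dots> \<le> \<mu> * (1 - \<epsilon>) * a" using \<open>b \<le> a\<close> \<mu> \<epsilon> by (intro mult_left_mono) auto
    also have "\<dots> < \<mu> * u" using u \<mu> by (simp add: mult.assoc)
    finally show False using k' by simp
  next
    case False
    then have "m (Suc j) \<le> m i" using strict_mono_less_eq[OF m(1)] by simp
    then have "g (m j) \<le> m i" using m(2)[of j] by linarith
    then have "M * a \<le> b" using g by (simp add: a_def b_def)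
    have "2 * \<kappa> * u < 2 * \<kappa> * ((1 + \<epsilon>) * a)" using u \<kappa> by simp
    also have "\<dots> = (1 - \<epsilon>) * (M * a)" unfolding \<epsilon>(2) M_def by simp
    also have "\<dots> \<le> (1 - \<epsilon>) * b" using \<open>M * a \<le> b\<close> \<epsilon> by (intro mult_left_mono) auto
    also have "\<dots> < v" by (rule v)
    finally show False using k' by simp
  qed
qed

section \<open>The characterisation of rotations\<close>

theorem theorem3p1:
  fixes r :: "nat \<Rightarrow> real" and \<Phi> :: "complex \<Rightarrow> complex"
  assumes "admissible_radii r"
    and "\<Phi> holomorphic_on ball 0 1"
    and "\<Phi> ` ball 0 1 \<subseteq> ball 0 1"
    and "continuous_on (cball 0 1) \<Phi>"
  shows "(\<forall>f\<in>Abel_universal_wrt r. f \<circ> \<Phi> \<in> Abel_universal) \<longleftrightarrow> is_disc_rotation \<Phi>"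
proof
  assume "is_disc_rotation \<Phi>"
  then obtain \<theta> where "\<And>z. z \<in> ball 0 1 \<Longrightarrow> \<Phi> z = exp (\<i> * of_real \<theta>) * z"
    unfolding is_disc_rotation_def by blast
  then have "f \<circ> \<Phi> \<in> Abel_universal_wrt r" if "f \<in> Abel_universal_wrt r" for f
    by (intro Abel_universal_wrt_rotate[OF assms(1) that]) auto
  then show "\<forall>f\<in>Abel_universal_wrt r. f \<circ> \<Phi> \<in> Abel_universal"
    using assms(1) unfolding Abel_universal_def by blast
next
  assume univ: "\<forall>f\<in>Abel_universal_wrt r. f \<circ> \<Phi> \<in> Abel_universal"
  have one: "norm (\<Phi> \<zeta>) = 1" if "\<zeta> \<in> sphere 0 1" for \<zeta>
    by (rule unimodular_boundary_values[OF assms(1,3,4) univ that])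
  obtain \<alpha> :: "real \<Rightarrow> real" where \<alpha>: "continuous_on UNIV \<alpha>" "\<And>x. 0 \<le> \<alpha> x"
    and lim: "\<And>x. ((\<lambda>t. (1 - norm (\<Phi> (of_real (exp (- t)) * cis x))) / t) \<longlongrightarrow> \<alpha> x) (at_right 0)"
    and const: "\<And>A. (\<And>x. \<alpha> x = A) \<Longrightarrow> \<exists>C. \<forall>w. 0 \<le> Im w \<longrightarrow> \<Phi> (exp (\<i> * w)) = C * exp (\<i> * of_real A * w)"
    using boundary_speed[OF assms(2-4) one] by blast
  have not_less: "\<not> \<alpha> x < \<alpha> y" for x y
  proof
    assume less: "\<alpha> x < \<alpha> y"
    have "\<exists>z. 0 < \<alpha> z \<and> \<alpha> z < \<alpha> y"
    proof (cases "0 < \<alpha> x")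
      case True
      with less show ?thesis by blast
    next
      case False
      then have x0: "\<alpha> x = 0" using \<alpha>(2)[of x] by simp
      \<comment> \<open>The comparison of speeds requires the smaller one to be positive; if
        \<open>\<alpha> x\<close> vanishes, the intermediate value theorem supplies a point with
        speed \<open>\<alpha> y / 2\<close>.\<close>
      have "connected (\<alpha> ` UNIV)" using \<alpha>(1) by (intro connected_continuous_image) auto
      then have "\<alpha> y / 2 \<in> \<alpha> ` UNIV"
        using connectedD_interval[of "\<alpha> ` UNIV" "\<alpha> x" "\<alpha> y" "\<alpha> y / 2"] less x0 by auto
      then obtain z where "\<alpha> y / 2 = \<alpha> z" by blast
      then show ?thesis using less x0 by (intro exI[of _ z]) auto
    qed
    then obtain z where "0 < \<alpha> z" "\<alpha> z < \<alpha> y" by blast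
    then show False
      using not_Abel_universal_if_distinct_speeds[OF assms(1,3,4) univ _ _ lim lim] by blast
  qed
  have "\<alpha> x = \<alpha> 0" for x using not_less[of x 0] not_less[of 0 x] by linarith
  then obtain C where C: "\<And>w. 0 \<le> Im w \<Longrightarrow> \<Phi> (exp (\<i> * w)) = C * exp (\<i> * of_real (\<alpha> 0) * w)"
    using const by metis
  obtain d where d: "d > 0" "norm C = 1" "\<And>z. z \<in> cball 0 1 \<Longrightarrow> \<Phi> z = C * z ^ d"
    using power_map_if_constant_speed[OF assms(3,4) one \<alpha>(2) C] by blast
  obtain f where "f \<in> Abel_universal_wrt r" using Abel_universal_wrt_nonempty[OF assms(1)] .
  then have "f \<circ> \<Phi> \<in> Abel_universal" using univ by blast
  then have "\<not> d \<ge> 2" using not_Abel_universal_if_power_ge_2[OF _ _ d(3)] by blast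
  then have "d = 1" using d(1) by simp
  obtain \<theta> where \<theta>: "0 \<le> \<theta>" "\<theta> < 2 * pi" "C = Complex (cos \<theta>) (sin \<theta>)"
    using complex_unimodular_polar[OF d(2)] by blast
  then have "C = exp (\<i> * of_real \<theta>)" by (simp add: cis_conv_exp[symmetric] cis.ctr)
  then show "is_disc_rotation \<Phi>"
    unfolding is_disc_rotation_def using d(3) \<open>d = 1\<close> \<theta> by (intro bexI[of _ \<theta>]) auto
qed

end
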